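(* Consider the epigraph problem of minimizing $a^\top x$ over $x=(y,t)\in X\subseteq\mathbb R^{n+N}$ (see context), over a time-invariant network of $N$ agents with digraph $G=(V,E)$, and the Decentralized Approximate Projection (DAP) algorithm for it (see context), in which every agent has local objective $\frac1N a^\top x$ and uses $s_{i,k}=a$ for all $i\in V$ and $k$. Suppose that conditions (B2)--(B4) of the context hold, that the optimal set $X^*=\operatorname{argmin}_{x\in X}a^\top x$ is nonempty, and that $G$ is strongly connected. Let the stepsize sequence $\{\alpha_k\}$ be nonnegative and nonincreasing with $\sum_{k=1}^\infty\alpha_k=\infty$ and $\sum_{k=1}^\infty\alpha_k^2<\infty$. Let $W_k=W$ for all $k\ge1$, where $W$ is the row stochastic matrix $$[W]_{ij}=\begin{cases}\frac1{\deg_i}&\text{if } j\in N_i^{\rm in},\\0&\text{otherwise.}\end{cases}$$ Then the iterates $\{x_{i,k}\}$ generated by all agents $i\in V$ via DAP converge almost surely to the same point of $X^*$; i.e., there is a random point $x^\star\in X^*$ such that $$\lim_{k\to\infty}x_{i,k}=x^\star\quad\text{for all } i\in V\quad\text{almost surely.}$$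
   Context: Network. $V=\{1,\dots,N\}$; $G=(V,E)$ is a fixed digraph, $(j,i)\in E$ meaning that $j$ can send to $i$; $N_i^{\rm in}=\{j\in V:(j,i)\in E\}\cup\{i\}$ and $\deg_i=|N_i^{\rm in}|$. Problem. The original problem is to minimize $\sum_{i\in V}f_i(y)$, $f_i:\mathbb R^n\to\mathbb R$, over $y$ in a common set $Y_0\subseteq\mathbb R^n$ subject to finitely many local inequality constraints on $y$. Its epigraph form has variable $x=(y,t)\in\mathbb R^{n}\times\mathbb R^{N}$, $t=(t_1,\dots,t_N)$, and objective $a^\top x$ with $a=(\mathbf 0,\mathbf 1)$ ($n$ zeros followed by $N$ ones), so $a^\top x=\sum_i t_i$. The common set is $X_0=Y_0\times\mathbb R^N$. For each $i\in V$, $\Omega_i$ is a finite set of constraint indices and $X_i=\{x\in\mathbb R^{n+N}:g(x,\omega)\le0\ \forall\omega\in\Omega_i\}$; each $g(\cdot,\omega)$ is either an original constraint (a function of $y$ only) or an epigraph constraint $f_j(y)-t_j$ for some $j$, and $\Omega_i$ always contains the index of the epigraph constraint $f_i(y)-t_i\le0$. The sets $\Omega_i$ may overlap. $X=X_0\cap\bigcap_{i\in V}X_i$. Put $g^+(x,\omega)=\max\{g(x,\omega),0\}$. $\|\cdot\|$ is the Euclidean norm, $\Pi_S$ the Euclidean projection onto a closed convex set $S$, and $\mathrm{dist}(x,S)=\min_{v\in S}\|v-x\|$. DAP algorithm. Given $x_{i,0}\in X_0$ ($i\in V$), for $k=1,2,\dots$ each agent $i$ computes $$p_{i,k}=\sum_{j\in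 V}[W_k]_{ij}x_{j,k-1},\quad v_{i,k}=\Pi_{X_0}[p_{i,k}-\alpha_k s_{i,k}],\quad x_{i,k}=\Pi_{X_0}\Big[v_{i,k}-\frac{g^+(v_{i,k},\omega_{i,k})}{\|d_{i,k}\|^2}d_{i,k}\Big],$$ where $s_{i,k}=a$, $\omega_{i,k}$ is a random variable with values in $\Omega_i$, $d_{i,k}\in\partial g^+(v_{i,k},\omega_{i,k})$ (subdifferential in the first argument) if $g^+(v_{i,k},\omega_{i,k})>0$, and $d_{i,k}=d_i$ for some fixed $d_i\ne0$ if $g^+(v_{i,k},\omega_{i,k})=0$. Let $\mathcal F_k=\{x_{i,0},(\omega_{i,t},1\le t\le k),i\in V\}$ be the history up to time $k$, $\mathcal F_0=\{x_{i,0},i\in V\}$. (B2) $Y_0$ (hence $X_0$) is nonempty, closed and convex. Each $f_i$ is convex (not necessarily differentiable) over some open set containing $Y_0$, with subgradients uniformly bounded over $Y_0$. For each $i\in V$, $\omega\in\Omega_i$, $g(\cdot,\omega)$ is defined and convex (not necessarily differentiable) over some open set containing $X_0$, and there is a scalar $C_g$ with $\|d\|\le C_g$ for all $d\in\partial g^+(x,\omega)$, $x\in X_0$, $\omega\in\Omega_i$, $i\in V$. (B3) For each $i$, the $\omega_{i,k}$, $k\ge1$, are i.i.d. samples from some probability distribution on the finite set $\Omega_i$, independent across agents, and each element of $\Omega_i$ has positive probability. (B4) For all $i\in V$ there exists a constant $c>0$ such that for all $x\in X_0$, $\mathrm{dist}^2(x,X)\le c\,\mathbb E[(g^+(x,\omega))^2\mid\mathcal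 F_{k-1}]$, where the expectation is over $\omega=\omega_{i,k}$ in $\Omega_i$ (by (B3) it is the expectation under the sampling distribution on $\Omega_i$). *)

theory Defs
  imports "HOL-Probability.Probability"
begin

definition in_nbrs :: "('v \<times> 'v) set \<Rightarrow> 'v \<Rightarrow> 'v set" where
  "in_nbrs E i = {j. (j, i) \<in> E} \<union> {i}"

definition uniform_weights :: "('v::finite \<times> 'v) set \<Rightarrow> real ^ 'v ^ 'v" where
  "uniform_weights E =
     (\<chi> i j. if j \<in> in_nbrs E i then 1 / real (card (in_nbrs E i)) else 0)"

definition pos_part :: "('b \<Rightarrow> 'w \<Rightarrow> real) \<Rightarrow> 'b \<Rightarrow> 'w \<Rightarrow> real" where
  "pos_part g x w = max (g x w) 0"

text \<open>The functions of interest are only meaningful on an open convex domain \<open>D\<close>; HOL functions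
  are total, so the domain is an explicit argument and values outside it are never used.\<close>

definition subdifferential :: "'b::real_inner set \<Rightarrow> ('b \<Rightarrow> real) \<Rightarrow> 'b \<Rightarrow> 'b set" where
  "subdifferential D h x = {d. \<forall>z\<in>D. h z \<ge> h x + inner d (z - x)}"

definition feasible_set :: "'b set \<Rightarrow> ('v \<Rightarrow> 'w set) \<Rightarrow> ('b \<Rightarrow> 'w \<Rightarrow> real) \<Rightarrow> 'b set" where
  "feasible_set X0 \<Omega> g = X0 \<inter> (\<Inter>i. {x. \<forall>w\<in>\<Omega> i. g x w \<le> 0})"

definition argmin_set :: "('b \<Rightarrow> real) \<Rightarrow> 'b set \<Rightarrow> 'b set" where
  "argmin_set h X = {x. is_arg_min h (\<lambda>z. z \<in> X) x}"

text \<open>A point \<open>(y, t)\<close> lives in \<open>real ^ 'n \<times> real ^ 'v\<close>, whose product norm is the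
  Euclidean norm of the concatenated vector.\<close>

definition epi_cost :: "(real ^ 'n) \<times> (real ^ 'v)" where
  "epi_cost = (0, \<chi> i. 1)"

definition is_epi_constraint ::
  "(real ^ 'n \<Rightarrow> real) \<Rightarrow> 'v \<Rightarrow> ((real ^ 'n) \<times> (real ^ 'v) \<Rightarrow> real) \<Rightarrow> bool" where
  "is_epi_constraint fj j h \<longleftrightarrow> (\<forall>y t. h (y, t) = fj y - t $ j)"

definition is_orig_constraint :: "((real ^ 'n) \<times> (real ^ 'v) \<Rightarrow> real) \<Rightarrow> bool" where
  "is_orig_constraint h \<longleftrightarrow> (\<exists>h0. \<forall>y t. h (y, t) = h0 y)"

text \<open>One realization of the algorithm. Iteration counters start at 1, so entries with index 0
  of \<open>W\<close>, \<open>\<alpha>\<close>, \<open>s\<close>, \<open>\<omega>\<close>, \<open>d\<close>, \<open>p\<close>, \<open>v\<close> are irrelevant. The domain of \<open>g(\<cdot>, w)\<close> is \<open>D w\<close>.\<close>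

definition dap_run ::
  "'b::euclidean_space set \<Rightarrow> ('w \<Rightarrow> 'b set) \<Rightarrow> ('b \<Rightarrow> 'w \<Rightarrow> real) \<Rightarrow>
   (nat \<Rightarrow> real ^ 'v ^ 'v) \<Rightarrow> (nat \<Rightarrow> real) \<Rightarrow> ('v::finite \<Rightarrow> nat \<Rightarrow> 'b) \<Rightarrow> ('v \<Rightarrow> 'b) \<Rightarrow>
   ('v \<Rightarrow> nat \<Rightarrow> 'w) \<Rightarrow> ('v \<Rightarrow> nat \<Rightarrow> 'b) \<Rightarrow>
   ('v \<Rightarrow> nat \<Rightarrow> 'b) \<Rightarrow> ('v \<Rightarrow> nat \<Rightarrow> 'b) \<Rightarrow> ('v \<Rightarrow> nat \<Rightarrow> 'b) \<Rightarrow> bool" where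
  "dap_run X0 D g W \<alpha> s dfix \<omega> d p v x \<longleftrightarrow>
     (\<forall>i. x i 0 \<in> X0) \<and>
     (\<forall>i. \<forall>k\<ge>1.
        p i k = (\<Sum>j\<in>UNIV. (W k $ i $ j) *\<^sub>R x j (k - 1)) \<and>
        v i k = closest_point X0 (p i k - \<alpha> k *\<^sub>R s i k) \<and>
        (pos_part g (v i k) (\<omega> i k) > 0 \<longrightarrow>
           d i k \<in> subdifferential (D (\<omega> i k)) (\<lambda>z. pos_part g z (\<omega> i k)) (v i k)) \<and>
        (pos_part g (v i k) (\<omega> i k) = 0 \<longrightarrow> d i k = dfix i) \<and>
        x i k = closest_point X0
          (v i k - (pos_part g (v i k) (\<omega> i k) / (norm (d i k))\<^sup>2) *\<^sub>R d i k))"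

definition sample_events :: "'a measure \<Rightarrow> ('v \<Rightarrow> nat \<Rightarrow> 'a \<Rightarrow> 'w) \<Rightarrow> nat set \<Rightarrow> 'a set set" where
  "sample_events M \<omega> K = {\<omega> i t -` A \<inter> space M | i t A. t \<in> K}"

text \<open>The sigma-algebra generated by the initial points and the samples up to time \<open>k\<close>.\<close>

definition history ::
  "'a measure \<Rightarrow> ('v \<Rightarrow> 'a \<Rightarrow> 'b::topological_space) \<Rightarrow> ('v \<Rightarrow> nat \<Rightarrow> 'a \<Rightarrow> 'w) \<Rightarrow> nat \<Rightarrow> 'a measure" where
  "history M x0 \<omega> k = sigma (space M)
     ({x0 i -` A \<inter> space M | i A. A \<in> sets borel} \<union> sample_events M \<omega> {1..k})"

end

theory Submission
  imports Defs
begin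

text \<open>
  Let \<open>\<pi> > 0\<close> be the stationary distribution of \<open>W\<close>, let \<open>u\<^sub>i\<close> be the projection of \<open>v\<^sub>i\<close> onto \<open>X\<close>, and
  for \<open>z \<in> X\<close> put \<open>V\<^sub>k(z) = \<Sum>\<^sub>i \<pi>\<^sub>i \<parallel>x\<^sub>i\<^sub>,\<^sub>k - z\<parallel>\<^sup>2\<close>.
  As all agents use the same direction \<open>a\<close>, every realization satisfies
  \<open>V\<^sub>k(z) + T\<^sub>k + 2 \<alpha>\<^sub>k \<Sum>\<^sub>i \<pi>\<^sub>i a\<bullet>(u\<^sub>i - z) + C\<^sup>-\<^sup>2 \<Sum>\<^sub>i \<pi>\<^sub>i g\<^sup>+(v\<^sub>i, \<omega>\<^sub>i)\<^sup>2
    \<le> V\<^sub>k\<^sub>-\<^sub>1(z) + 3 \<alpha>\<^sub>k\<^sup>2 \<parallel>a\<parallel>\<^sup>2 + 2 \<alpha>\<^sub>k \<parallel>a\<parallel> \<Sum>\<^sub>i \<pi>\<^sub>i dist(v\<^sub>i, X)\<close>,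
  where \<open>T\<^sub>k = \<Sum>\<^sub>i\<^sub>j \<pi>\<^sub>i W\<^sub>i\<^sub>j \<parallel>x\<^sub>j\<^sub>,\<^sub>k\<^sub>-\<^sub>1 - p\<^sub>i\<^sub>,\<^sub>k\<parallel>\<^sup>2\<close> is the variance removed by averaging.
  Randomness enters once: the sample \<open>\<omega>\<^sub>i\<^sub>,\<^sub>k\<close> is independent of \<open>v\<^sub>i\<^sub>,\<^sub>k\<close>, so by (B4) the expectation of
  \<open>dist(v\<^sub>i, X)\<^sup>2\<close> is at most \<open>c\<close> times that of \<open>g\<^sup>+(v\<^sub>i, \<omega>\<^sub>i)\<^sup>2\<close>; summing the expected inequality gives
  \<open>\<Sum>\<^sub>k dist(v\<^sub>i\<^sub>,\<^sub>k, X)\<^sup>2 < \<infinity>\<close> almost surely, without any martingale argument.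
  On such a realization \<open>V\<^sub>k(z)\<close> converges for every optimal \<open>z\<close>, \<open>T\<^sub>k \<rightarrow> 0\<close> yields consensus along the
  edges and hence everywhere, and \<open>\<Sum> \<alpha>\<^sub>k = \<infinity>\<close> yields a limit point \<open>l \<in> X\<^sup>*\<close> common to all agents;
  since \<open>V\<^sub>k(l)\<close> converges and tends to 0 along a subsequence, all iterates converge to \<open>l\<close>.
\<close>

section \<open>Weights, projections and quasi-Fejer sequences\<close>

text \<open>Since all rows sum to one, \<open>W - mat 1\<close> is singular and \<open>W\<close> has
  a nonzero left fixed vector. Its vector of absolute values turns out to be fixed as well, and
  strong connectivity makes that vector positive before it is normalized.\<close>

lemma stationary_weights_exist:
  fixes W :: "real ^ 'v ^ 'v"
  assumes W_nonneg: "\<And>i j. W $ i $ j \<ge> 0"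
    and W_rows: "\<And>i. (\<Sum>j\<in>UNIV. W $ i $ j) = 1"
    and W_edge: "\<And>i j. (j, i) \<in> E \<Longrightarrow> W $ i $ j > 0"
    and connected: "\<And>i j. (i, j) \<in> E\<^sup>*"
  obtains \<pi> :: "'v \<Rightarrow> real" where "\<And>i. \<pi> i > 0" "(\<Sum>i\<in>UNIV. \<pi> i) = 1"
    "\<And>j. (\<Sum>i\<in>UNIV. \<pi> i * W $ i $ j) = \<pi> j"
proof -
  define A where "A = W - mat 1"
  have "A *v 1 = 0"
    unfolding A_def matrix_vector_mult_diff_rdistrib
    by (simp add: vec_eq_iff matrix_vector_mult_def[of W] W_rows)
  then have "\<not> (\<exists>B. B ** A = mat 1)"
    unfolding matrix_left_invertible_ker by (metis one_neq_zero)
  \<comment> \<open>For square matrices left and right invertibility agree, so the kernel vector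
    \<open>1\<close> of \<open>A\<close> forces a nonzero kernel vector of the transpose.\<close>
  then have "\<not> (\<exists>B. B ** transpose A = mat 1)"
    by (metis matrix_left_right_inverse left_invertible_transpose)
  then obtain y where y: "transpose A *v y = 0" "y \<noteq> 0"
    unfolding matrix_left_invertible_ker by blast
  have y_inv: "(\<Sum>i\<in>UNIV. y $ i * W $ i $ j) = y $ j" for j
  proof -
    have "transpose A = transpose W - mat 1"
      by (simp add: A_def transpose_def mat_def vec_eq_iff)
    then have "(transpose A *v y) $ j = (transpose W *v y) $ j - y $ j"
      by (simp only: matrix_vector_mult_diff_rdistrib matrix_vector_mul_lid vector_minus_component)
    also have "(transpose W *v y) $ j = (\<Sum>i\<in>UNIV. y $ i * W $ i $ j)"
      by (simp add: matrix_vector_mult_def transpose_def mult.commute)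
    finally have "(transpose A *v y) $ j = (\<Sum>i\<in>UNIV. y $ i * W $ i $ j) - y $ j" .
    with y(1) show ?thesis by (simp only: zero_index)
  qed
  define z where "z i = \<bar>y $ i\<bar>" for i
  have z_le: "z j \<le> (\<Sum>i\<in>UNIV. z i * W $ i $ j)" for j
  proof -
    have "z j = \<bar>\<Sum>i\<in>UNIV. y $ i * W $ i $ j\<bar>" by (simp add: y_inv z_def)
    also have "\<dots> \<le> (\<Sum>i\<in>UNIV. \<bar>y $ i * W $ i $ j\<bar>)" by (rule sum_abs)
    also have "\<dots> = (\<Sum>i\<in>UNIV. z i * W $ i $ j)" by (simp add: abs_mult z_def W_nonneg)
    finally show ?thesis .
  qed
  \<comment> \<open>Averaging preserves total mass: the nonnegative gaps in \<open>z_le\<close> add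
    up to zero, so each of them vanishes.\<close>
  have "(\<Sum>j\<in>UNIV. \<Sum>i\<in>UNIV. z i * W $ i $ j) = (\<Sum>i\<in>UNIV. z i * (\<Sum>j\<in>UNIV. W $ i $ j))"
    by (subst sum.swap) (simp add: sum_distrib_left)
  then have total: "(\<Sum>j\<in>UNIV. (\<Sum>i\<in>UNIV. z i * W $ i $ j) - z j) = 0"
    by (simp add: W_rows sum_subtractf)
  have z_inv: "(\<Sum>i\<in>UNIV. z i * W $ i $ j) = z j" for j
    using sum_nonneg_eq_0_iff[of UNIV "\<lambda>j. (\<Sum>i\<in>UNIV. z i * W $ i $ j) - z j"] total z_le by simp
  obtain i0 where "z i0 \<noteq> 0" using y(2) by (auto simp: z_def vec_eq_iff)
  then have i0: "z i0 > 0" by (auto simp: z_def)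
  \<comment> \<open>Positivity passes from the receiver \<open>i\<close> to the sender
    \<open>j\<close>, hence backwards along a path that ends in \<open>i0\<close>.\<close>
  have step: "z j > 0" if "z i > 0" "(j, i) \<in> E" for i j
  proof -
    have "0 < z i * W $ i $ j" using that W_edge by simp
    also have "\<dots> \<le> (\<Sum>i\<in>UNIV. z i * W $ i $ j)"
      by (rule member_le_sum[of i UNIV "\<lambda>i. z i * W $ i $ j"]) (auto simp: z_def W_nonneg)
    finally show ?thesis by (simp add: z_inv)
  qed
  have pos: "z j > 0" for j
    using connected[of j i0] by (induction rule: converse_rtrancl_induct) (auto intro: i0 step)
  define s where "s = (\<Sum>i\<in>UNIV. z i)"
  have s: "s > 0" unfolding s_def by (intro sum_pos pos) auto
  show ?thesis
  proof (rule that[of "\<lambda>i. z i / s"])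
    show "z i / s > 0" for i using pos s by simp
    show "(\<Sum>i\<in>UNIV. z i / s) = 1" using s by (simp add: s_def flip: sum_divide_distrib)
    show "(\<Sum>i\<in>UNIV. z i / s * W $ i $ j) = z j / s" for j
      by (simp flip: z_inv[of j] add: sum_divide_distrib)
  qed
qed

text \<open>Bias-variance decomposition: expanding around the weighted mean \<open>m\<close>, the
  cross term vanishes because the deviations from \<open>m\<close> average to zero.\<close>

lemma weighted_variance:
  fixes x :: "'v::finite \<Rightarrow> 'b::real_inner"
  assumes "(\<Sum>j\<in>UNIV. w j) = 1" "m = (\<Sum>j\<in>UNIV. w j *\<^sub>R x j)"
  shows "(norm (m - z))\<^sup>2 + (\<Sum>j\<in>UNIV. w j * (norm (x j - m))\<^sup>2)
    = (\<Sum>j\<in>UNIV. w j * (norm (x j - z))\<^sup>2)"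
proof -
  have "(norm (x j - z))\<^sup>2 = (norm (x j - m))\<^sup>2 + 2 * inner (m - z) (x j - m) + (norm (m - z))\<^sup>2" for j
    by (simp add: power2_norm_eq_inner inner_diff inner_commute algebra_simps)
  then have "(\<Sum>j\<in>UNIV. w j * (norm (x j - z))\<^sup>2) =
    (\<Sum>j\<in>UNIV. w j * (norm (x j - m))\<^sup>2) + 2 * (\<Sum>j\<in>UNIV. w j * inner (m - z) (x j - m))
      + (\<Sum>j\<in>UNIV. w j) * (norm (m - z))\<^sup>2"
    by (simp only: distrib_left sum.distrib sum_distrib_left sum_distrib_right) (simp only: mult_ac)
  moreover have "(\<Sum>j\<in>UNIV. w j * inner (m - z) (x j - m)) = inner (m - z) (\<Sum>j\<in>UNIV. w j *\<^sub>R (x j - m))"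
    by (simp add: inner_sum_right)
  moreover have "(\<Sum>j\<in>UNIV. w j *\<^sub>R (x j - m)) = 0"
    by (simp add: scaleR_right_diff_distrib sum_subtractf assms flip: scaleR_sum_left)
  ultimately show ?thesis using assms by simp
qed

lemma norm_closest_point_le:
  fixes S :: "'b::euclidean_space set"
  assumes "convex S" "closed S" "z \<in> S"
  shows "norm (closest_point S y - z) \<le> norm (y - z)"
  using closest_point_lipschitz[OF assms(1,2), of y z] assms closest_point_self[of z S]
  by (auto simp: dist_norm)

text \<open>The subgradient inequality tested at \<open>z\<close>, where \<open>h\<close> is
  nonpositive, gives \<open>h v \<le> inner d (v - z)\<close>. The step length
  \<open>h v / (norm d)\<^sup>2\<close> minimizes the resulting quadratic bound and lowers it by
  \<open>(h v)\<^sup>2 / (norm d)\<^sup>2\<close>.\<close>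

lemma polyak_step:
  fixes S :: "'b::euclidean_space set"
  assumes S: "convex S" "closed S" "z \<in> S"
    and z: "z \<in> D" "h z \<le> 0"
    and h: "h v \<ge> 0"
    and d: "h v > 0 \<Longrightarrow> d \<in> subdifferential D h v" "h v > 0 \<Longrightarrow> norm d \<le> C"
    and C: "C > 0"
  shows "(norm (closest_point S (v - (h v / (norm d)\<^sup>2) *\<^sub>R d) - z))\<^sup>2 + (h v)\<^sup>2 / C\<^sup>2 \<le> (norm (v - z))\<^sup>2"
proof (cases "h v = 0")
  case True
  \<comment> \<open>With zero residual the step vanishes whatever \<open>d\<close> is, and only the
    projection acts.\<close>
  then show ?thesis
    using norm_closest_point_le[OF S, of v] by (simp add: power_mono)
next
  case False
  with h have hv: "h v > 0" by simp
  have sub: "h v \<le> inner d (v - z)"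
    using d(1)[OF hv] z by (auto simp: subdifferential_def inner_diff)
  with hv have "d \<noteq> 0" by auto
  define n where "n = (norm d)\<^sup>2"
  have n: "n > 0" "n \<le> C\<^sup>2" using \<open>d \<noteq> 0\<close> d(2)[OF hv] by (auto simp: n_def intro: power_mono)
  have dn: "inner d d = n" by (simp add: n_def power2_norm_eq_inner)
  have "(norm (closest_point S (v - (h v / n) *\<^sub>R d) - z))\<^sup>2 \<le> (norm (v - (h v / n) *\<^sub>R d - z))\<^sup>2"
    by (intro power_mono norm_closest_point_le S) auto
  also have "\<dots> = (norm (v - z))\<^sup>2 - 2 * (h v / n) * inner d (v - z) + (h v / n)\<^sup>2 * n"
  proof -
    have "(norm (q - t *\<^sub>R d))\<^sup>2 = (norm q)\<^sup>2 - 2 * t * inner d q + t\<^sup>2 * inner d d" for q t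
      by (simp add: power2_norm_eq_inner inner_diff inner_commute algebra_simps power2_eq_square[of t])
    from this[of "v - z" "h v / n"] show ?thesis by (simp add: dn algebra_simps)
  qed
  also have "\<dots> \<le> (norm (v - z))\<^sup>2 - 2 * (h v / n) * h v + (h v / n)\<^sup>2 * n"
    using sub hv n by (intro add_right_mono diff_left_mono mult_left_mono) auto
  also have "\<dots> = (norm (v - z))\<^sup>2 - (h v)\<^sup>2 / n"
    using n by (simp add: power2_eq_square field_simps)
  also have "(h v)\<^sup>2 / C\<^sup>2 \<le> (h v)\<^sup>2 / n"
    using n C by (intro divide_left_mono) auto
  then have "(norm (v - z))\<^sup>2 - (h v)\<^sup>2 / n \<le> (norm (v - z))\<^sup>2 - (h v)\<^sup>2 / C\<^sup>2" by simp
  finally show ?thesis by (simp add: n_def)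
qed

text \<open>The perturbations are absorbed into the sequence: \<open>A n - sum b {..<n}\<close>
  decreases and stays above \<open>- suminf b\<close>. Telescoping bounds the partial sums of
  \<open>c\<close>.\<close>

lemma quasi_fejer:
  fixes A b c :: "nat \<Rightarrow> real"
  assumes step: "\<And>n. A (Suc n) + c n \<le> A n + b n"
    and nonneg: "\<And>n. A n \<ge> 0" "\<And>n. c n \<ge> 0" "\<And>n. b n \<ge> 0"
    and b: "summable b"
  shows "convergent A" and "summable c"
proof -
  have *: "A n + sum c {..<n} \<le> A 0 + sum b {..<n}" for n
  proof (induction n)
    case (Suc n)
    then show ?case using step[of n] by simp
  qed simp
  have bb: "sum b {..<n} \<le> suminf b" for n
    by (rule sum_le_suminf[OF b]) (auto intro: nonneg)
  show "summable c"
  proof (rule summableI_nonneg_bounded)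
    show "sum c {..<n} \<le> A 0 + suminf b" for n
      using *[of n] bb[of n] nonneg(1)[of n] by linarith
  qed (rule nonneg)
  obtain L where "(\<lambda>n. A n - sum b {..<n}) \<longlonglongrightarrow> L"
  proof (rule decseq_convergent[of "\<lambda>n. A n - sum b {..<n}" "- suminf b"])
    show "decseq (\<lambda>n. A n - sum b {..<n})"
    proof (rule decseq_SucI)
      show "A (Suc n) - sum b {..<Suc n} \<le> A n - sum b {..<n}" for n
        using step[of n] nonneg(2)[of n] by simp
    qed
    show "\<forall>i. - suminf b \<le> A i - sum b {..<i}"
    proof
      show "- suminf b \<le> A i - sum b {..<i}" for i
        using bb[of i] nonneg(1)[of i] by linarith
    qed
  qed
  then have "convergent (\<lambda>n. A n - sum b {..<n})" by (rule convergentI)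
  moreover have "convergent (\<lambda>n. sum b {..<n})"
    using b by (simp add: summable_iff_convergent)
  ultimately have "convergent (\<lambda>n. (A n - sum b {..<n}) + sum b {..<n})"
    by (rule convergent_add)
  then show "convergent A" by simp
qed

lemma summable_mult_of_squares:
  fixes a b :: "nat \<Rightarrow> real"
  assumes "summable (\<lambda>n. (a n)\<^sup>2)" "summable (\<lambda>n. (b n)\<^sup>2)"
  shows "summable (\<lambda>n. a n * b n)"
proof (rule summable_comparison_test'[OF summable_add[OF assms]])
  fix n
  have "2 * (\<bar>a n\<bar> * \<bar>b n\<bar>) \<le> (a n)\<^sup>2 + (b n)\<^sup>2"
    using sum_squares_bound[of "\<bar>a n\<bar>" "\<bar>b n\<bar>"] by (simp add: mult.assoc)
  moreover have "0 \<le> \<bar>a n\<bar> * \<bar>b n\<bar>" by simp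
  ultimately show "norm (a n * b n) \<le> (a n)\<^sup>2 + (b n)\<^sup>2" by (simp only: real_norm_def abs_mult)
qed

text \<open>Otherwise the summable \<open>a n * G n\<close> would dominate
  \<open>\<epsilon> * a n\<close> from \<open>m\<close> on, and the divergent sum of
  \<open>a\<close> would converge. This supplies late times with a small optimality gap.\<close>

lemma summable_weight_small:
  fixes a G :: "nat \<Rightarrow> real"
  assumes sum: "summable (\<lambda>n. a n * G n)"
    and div: "filterlim (\<lambda>N. \<Sum>n<N. a n) at_top sequentially"
    and a: "\<And>n. a n \<ge> 0" and \<epsilon>: "\<epsilon> > 0"
  shows "\<exists>n\<ge>m. G n < \<epsilon>"
proof (rule ccontr)
  assume "\<not> ?thesis"
  then have G: "G n \<ge> \<epsilon>" if "n \<ge> m" for n using that by force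
  have "summable (\<lambda>n. \<epsilon> * a n)"
  proof (rule summable_comparison_test'[OF sum])
    show "norm (\<epsilon> * a n) \<le> a n * G n" if "n \<ge> m" for n
      using mult_right_mono[OF G[OF that] a[of n]] a[of n] \<epsilon> by (simp add: abs_mult mult.commute)
  qed
  then have "summable (\<lambda>n. (1 / \<epsilon>) * (\<epsilon> * a n))" by (rule summable_mult)
  then have "summable a" using \<epsilon> by simp
  then have "(\<lambda>N. \<Sum>n<N. a n) \<longlonglongrightarrow> suminf a" by (rule summable_LIMSEQ)
  with div show False using not_tendsto_and_filterlim_at_infinity
    by (metis filterlim_at_top_imp_at_infinity sequentially_bot)
qed

section \<open>A single run of the algorithm\<close>

text \<open>Here \<open>h i n\<close> stands for the residual \<open>g\<^sup>+(v\<^sub>i\<^sub>,\<^sub>n, \<omega>\<^sub>i\<^sub>,\<^sub>n)\<close>; the feasibility step enters only through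
  the Polyak inequality \<open>x_step\<close>.\<close>

locale dap_path =
  fixes X0 X :: "'b::euclidean_space set" and a :: 'b
    and E :: "('v::finite \<times> 'v) set" and w :: "'v \<Rightarrow> 'v \<Rightarrow> real" and \<pi> :: "'v \<Rightarrow> real"
    and \<alpha> :: "nat \<Rightarrow> real" and C :: real and h :: "'v \<Rightarrow> nat \<Rightarrow> real"
    and p v x :: "'v \<Rightarrow> nat \<Rightarrow> 'b"
  assumes X0: "closed X0" "convex X0"
    and X: "closed X" "X \<subseteq> X0" "X \<noteq> {}"
    and w_nonneg: "\<And>i j. w i j \<ge> 0" and w_rows: "\<And>i. (\<Sum>j\<in>UNIV. w i j) = 1"
    and w_edge: "\<And>i j. (j, i) \<in> E \<Longrightarrow> w i j > 0" and w_self: "\<And>i. w i i > 0"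
    and connected: "\<And>i j. (i, j) \<in> E\<^sup>*"
    and \<pi>_pos: "\<And>i. \<pi> i > 0" and \<pi>_sum: "(\<Sum>i\<in>UNIV. \<pi> i) = 1"
    and \<pi>_inv: "\<And>j. (\<Sum>i\<in>UNIV. \<pi> i * w i j) = \<pi> j"
    and \<alpha>_nonneg: "\<And>n. \<alpha> (Suc n) \<ge> 0"
    and x_in: "\<And>i n. x i n \<in> X0"
    and p_eq: "\<And>i n. p i (Suc n) = (\<Sum>j\<in>UNIV. w i j *\<^sub>R x j n)"
    and v_eq: "\<And>i n. v i (Suc n) = closest_point X0 (p i (Suc n) - \<alpha> (Suc n) *\<^sub>R a)"
    and x_step: "\<And>i n z. z \<in> X \<Longrightarrow>
      (norm (x i (Suc n) - z))\<^sup>2 + (h i (Suc n))\<^sup>2 / C\<^sup>2 \<le> (norm (v i (Suc n) - z))\<^sup>2"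
begin

definition u :: "'v \<Rightarrow> nat \<Rightarrow> 'b" where "u i n = closest_point X (v i n)"

definition V :: "'b \<Rightarrow> nat \<Rightarrow> real" where "V z n = (\<Sum>i\<in>UNIV. \<pi> i * (norm (x i n - z))\<^sup>2)"

text \<open>This is \<open>T\<^sub>k\<close> of the overview for \<open>k = Suc n\<close>: the index
  is that of the iterates before averaging.\<close>

definition T :: "nat \<Rightarrow> real" where
  "T n = (\<Sum>i\<in>UNIV. \<pi> i * (\<Sum>j\<in>UNIV. w i j * (norm (x j n - p i (Suc n)))\<^sup>2))"

lemma u_in: "u i n \<in> X"
  unfolding u_def using X by (intro closest_point_in_set) auto

lemma infdist_v: "infdist (v i n) X = norm (v i n - u i n)"
  using setdist_closest_point[OF X(1,3), of "v i n"] 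
  by (simp add: u_def infdist_eq_setdist dist_norm)

lemma p_in: "p i (Suc n) \<in> X0"
  unfolding p_eq by (intro convex_sum X0) (auto simp: w_rows w_nonneg x_in)

text \<open>Since \<open>p\<close> already lies in \<open>X0\<close>, projecting the shifted point
  cannot take it further from \<open>p\<close> than the shift did.\<close>

lemma norm_v_minus_p: "norm (v i (Suc n) - p i (Suc n)) \<le> \<alpha> (Suc n) * norm a"
  using norm_closest_point_le[OF X0(2,1) p_in[of i n], of "p i (Suc n) - \<alpha> (Suc n) *\<^sub>R a"] \<alpha>_nonneg[of n]
  by (simp add: v_eq)

lemma norm_x_le_v: assumes "z \<in> X" shows "norm (x i (Suc n) - z) \<le> norm (v i (Suc n) - z)"
proof (rule power2_le_imp_le)
  show "(norm (x i (Suc n) - z))\<^sup>2 \<le> (norm (v i (Suc n) - z))\<^sup>2"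
    using x_step[OF assms, of i n] divide_nonneg_nonneg[OF zero_le_power2 zero_le_power2, of "h i (Suc n)" C]
    by linarith
qed simp

text \<open>The expansion produces the cost at \<open>p\<close>, but the gap to an optimum has a
  known sign only at feasible points, so the cost is transported from \<open>p\<close> over
  \<open>v\<close> to \<open>u\<close>. The coefficient 3 is one square from the expansion plus
  twice \<open>\<alpha> * norm a * norm a\<close> times \<open>\<alpha>\<close> from the passage to
  \<open>v\<close>.\<close>

lemma v_step:
  assumes "z \<in> X"
  shows "(norm (v i (Suc n) - z))\<^sup>2 + 2 * \<alpha> (Suc n) * inner a (u i (Suc n) - z)
    \<le> (norm (p i (Suc n) - z))\<^sup>2 + 3 * (\<alpha> (Suc n) * norm a)\<^sup>2
        + 2 * \<alpha> (Suc n) * norm a * norm (v i (Suc n) - u i (Suc n))"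
proof -
  let ?p = "p i (Suc n)" and ?v = "v i (Suc n)" and ?u = "u i (Suc n)" and ?\<alpha> = "\<alpha> (Suc n)"
  have "(norm (?v - z))\<^sup>2 \<le> (norm (?p - ?\<alpha> *\<^sub>R a - z))\<^sup>2"
    unfolding v_eq using X0 X assms by (intro power_mono norm_closest_point_le) auto
  also have "\<dots> = (norm (?p - z))\<^sup>2 - 2 * ?\<alpha> * inner a (?p - z) + (?\<alpha> * norm a)\<^sup>2"
    by (simp add: power2_norm_eq_inner power_mult_distrib inner_diff inner_commute algebra_simps power2_eq_square[of ?\<alpha>])
  finally have 1: "(norm (?v - z))\<^sup>2 \<le> (norm (?p - z))\<^sup>2 - 2 * ?\<alpha> * inner a (?p - z) + (?\<alpha> * norm a)\<^sup>2" .
  have "inner a (?v - ?p) \<le> norm a * (?\<alpha> * norm a)"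
    by (rule order.trans[OF norm_cauchy_schwarz]) (intro mult_left_mono norm_v_minus_p, simp)
  moreover have "inner a (?u - ?v) \<le> norm a * norm (?v - ?u)"
    using norm_cauchy_schwarz[of a "?u - ?v"] by (simp add: norm_minus_commute)
  ultimately have "inner a (?u - z) \<le> inner a (?p - z) + norm a * (?\<alpha> * norm a) + norm a * norm (?v - ?u)"
    by (simp add: inner_diff)
  then have "2 * ?\<alpha> * inner a (?u - z) \<le> 2 * ?\<alpha> * (inner a (?p - z) + norm a * (?\<alpha> * norm a) + norm a * norm (?v - ?u))"
    using \<alpha>_nonneg[of n] by (intro mult_left_mono) auto
  with 1 show ?thesis by (simp add: power2_eq_square algebra_simps)
qed

text \<open>\<open>weighted_variance\<close> is applied at each receiver. Summing over receivers,
  stationarity turns the weights \<open>\<pi> i * w i j\<close> into \<open>\<pi> j\<close>; this is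
  why the Lyapunov function is weighted by \<open>\<pi>\<close>.\<close>

lemma p_variance:
  "(\<Sum>i\<in>UNIV. \<pi> i * (norm (p i (Suc n) - z))\<^sup>2) + T n = V z n"
proof -
  have "(\<Sum>i\<in>UNIV. \<pi> i * (norm (p i (Suc n) - z))\<^sup>2) + T n
    = (\<Sum>i\<in>UNIV. \<pi> i * (\<Sum>j\<in>UNIV. w i j * (norm (x j n - z))\<^sup>2))"
    unfolding T_def sum.distrib[symmetric] distrib_left[symmetric]
    by (intro sum.cong refl arg_cong2[of _ _ _ _ "(*)"] weighted_variance w_rows p_eq)
  also have "\<dots> = (\<Sum>j\<in>UNIV. (\<Sum>i\<in>UNIV. \<pi> i * w i j) * (norm (x j n - z))\<^sup>2)"
    unfolding sum_distrib_left sum_distrib_right by (subst sum.swap) (simp add: mult.assoc)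
  finally show ?thesis by (simp add: \<pi>_inv V_def)
qed

lemma T_nonneg: "T n \<ge> 0"
  unfolding T_def by (intro sum_nonneg mult_nonneg_nonneg less_imp_le[OF \<pi>_pos] w_nonneg) auto

lemma V_nonneg: "V z n \<ge> 0"
  unfolding V_def by (intro sum_nonneg mult_nonneg_nonneg less_imp_le[OF \<pi>_pos]) auto

text \<open>The \<open>\<pi>\<close>-weighted sum of \<open>v_step\<close> and
  \<open>x_step\<close>, with \<open>p_variance\<close> leading back to the previous
  iterates.\<close>

lemma V_step:
  assumes "z \<in> X"
  shows "V z (Suc n) + T n + 2 * \<alpha> (Suc n) * (\<Sum>i\<in>UNIV. \<pi> i * inner a (u i (Suc n) - z))
      + (\<Sum>i\<in>UNIV. \<pi> i * (h i (Suc n))\<^sup>2) / C\<^sup>2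
    \<le> V z n + 3 * (\<alpha> (Suc n) * norm a)\<^sup>2
      + 2 * \<alpha> (Suc n) * norm a * (\<Sum>i\<in>UNIV. \<pi> i * infdist (v i (Suc n)) X)"
proof -
  let ?\<alpha> = "\<alpha> (Suc n)"
  have "(\<Sum>i\<in>UNIV. \<pi> i * ((norm (x i (Suc n) - z))\<^sup>2 + (h i (Suc n))\<^sup>2 / C\<^sup>2
        + 2 * ?\<alpha> * inner a (u i (Suc n) - z)))
    \<le> (\<Sum>i\<in>UNIV. \<pi> i * ((norm (p i (Suc n) - z))\<^sup>2 + 3 * (?\<alpha> * norm a)\<^sup>2
        + 2 * ?\<alpha> * norm a * infdist (v i (Suc n)) X))"
  proof (intro sum_mono mult_left_mono)
    fix i
    show "(norm (x i (Suc n) - z))\<^sup>2 + (h i (Suc n))\<^sup>2 / C\<^sup>2 + 2 * ?\<alpha> * inner a (u i (Suc n) - z)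
      \<le> (norm (p i (Suc n) - z))\<^sup>2 + 3 * (?\<alpha> * norm a)\<^sup>2 + 2 * ?\<alpha> * norm a * infdist (v i (Suc n)) X"
      using v_step[OF assms, of i n] x_step[OF assms, of i n] unfolding infdist_v by linarith
  qed (simp add: less_imp_le[OF \<pi>_pos])
  moreover have "(\<Sum>i\<in>UNIV. \<pi> i * ((norm (x i (Suc n) - z))\<^sup>2 + (h i (Suc n))\<^sup>2 / C\<^sup>2
        + 2 * ?\<alpha> * inner a (u i (Suc n) - z))) = V z (Suc n)
      + (\<Sum>i\<in>UNIV. \<pi> i * (h i (Suc n))\<^sup>2) / C\<^sup>2
      + 2 * ?\<alpha> * (\<Sum>i\<in>UNIV. \<pi> i * inner a (u i (Suc n) - z))"
    by (simp add: distrib_left sum.distrib V_def sum_divide_distrib)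
       (simp add: sum_distrib_left mult_ac)
  moreover have "(\<Sum>i\<in>UNIV. \<pi> i * ((norm (p i (Suc n) - z))\<^sup>2 + 3 * (?\<alpha> * norm a)\<^sup>2
        + 2 * ?\<alpha> * norm a * infdist (v i (Suc n)) X))
      = (\<Sum>i\<in>UNIV. \<pi> i * (norm (p i (Suc n) - z))\<^sup>2) + (\<Sum>i\<in>UNIV. \<pi> i) * (3 * (?\<alpha> * norm a)\<^sup>2)
      + 2 * ?\<alpha> * norm a * (\<Sum>i\<in>UNIV. \<pi> i * infdist (v i (Suc n)) X)"
    unfolding sum_distrib_left sum_distrib_right by (simp add: distrib_left sum.distrib mult_ac)
  ultimately show ?thesis using p_variance[of n z] by (simp add: \<pi>_sum)
qed

text \<open>Young's inequality trades the term linear in the distance for \<open>\<eta>\<close>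
  times its square, the quantity that regularity controls in expectation. For optimal
  \<open>z\<close> the cost gap at \<open>u\<close> is nonnegative and is dropped together with
  \<open>T\<close>.\<close>

lemma V_descent:
  assumes z: "z \<in> X" "\<And>y. y \<in> X \<Longrightarrow> inner a z \<le> inner a y" and \<eta>: "\<eta> > 0"
  shows "(\<Sum>i\<in>UNIV. \<pi> i * (norm (x i (Suc n) - z))\<^sup>2) + (\<Sum>i\<in>UNIV. \<pi> i * (h i (Suc n))\<^sup>2) / C\<^sup>2
    \<le> (\<Sum>i\<in>UNIV. \<pi> i * (norm (x i n - z))\<^sup>2) + (3 + 1 / \<eta>) * (\<alpha> (Suc n) * norm a)\<^sup>2
      + \<eta> * (\<Sum>i\<in>UNIV. \<pi> i * (infdist (v i (Suc n)) X)\<^sup>2)"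
proof -
  define s where "s = \<alpha> (Suc n) * norm a"
  have young: "2 * s * e \<le> s\<^sup>2 / \<eta> + \<eta> * e\<^sup>2" for e
  proof -
    have "0 \<le> (s - \<eta> * e)\<^sup>2 / \<eta>" using \<eta> by simp
    also have "\<dots> = s\<^sup>2 / \<eta> + \<eta> * e\<^sup>2 - 2 * s * e"
      using \<eta> by (simp add: power2_eq_square field_simps)
    finally show ?thesis by simp
  qed
  have "2 * \<alpha> (Suc n) * norm a * (\<Sum>i\<in>UNIV. \<pi> i * infdist (v i (Suc n)) X)
    = (\<Sum>i\<in>UNIV. \<pi> i * (2 * s * infdist (v i (Suc n)) X))"
    by (simp add: s_def sum_distrib_left mult_ac)
  also have "\<dots> \<le> (\<Sum>i\<in>UNIV. \<pi> i * (s\<^sup>2 / \<eta> + \<eta> * (infdist (v i (Suc n)) X)\<^sup>2))"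
    by (intro sum_mono mult_left_mono young less_imp_le[OF \<pi>_pos])
  also have "\<dots> = (\<Sum>i\<in>UNIV. \<pi> i) * (s\<^sup>2 / \<eta>) + \<eta> * (\<Sum>i\<in>UNIV. \<pi> i * (infdist (v i (Suc n)) X)\<^sup>2)"
    by (simp only: distrib_left sum.distrib sum_distrib_left sum_distrib_right) (simp only: mult_ac)
  finally have "2 * \<alpha> (Suc n) * norm a * (\<Sum>i\<in>UNIV. \<pi> i * infdist (v i (Suc n)) X)
      \<le> s\<^sup>2 / \<eta> + \<eta> * (\<Sum>i\<in>UNIV. \<pi> i * (infdist (v i (Suc n)) X)\<^sup>2)"
    by (simp add: \<pi>_sum)
  moreover have "0 \<le> 2 * \<alpha> (Suc n) * (\<Sum>i\<in>UNIV. \<pi> i * inner a (u i (Suc n) - z))"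
    using z(2)[OF u_in]
    by (intro mult_nonneg_nonneg sum_nonneg less_imp_le[OF \<pi>_pos]) (auto simp: inner_diff \<alpha>_nonneg)
  ultimately show ?thesis
    using V_step[OF z(1), of n] T_nonneg[of n] unfolding V_def
    by (simp add: s_def distrib_right)
qed

text \<open>Dropping the new iterate from \<open>x_step\<close> bounds the residual by a distance,
  which makes it integrable on events where the iterates are bounded.\<close>

lemma h_le:
  assumes "z \<in> X" "C > 0"
  shows "(h i (Suc n))\<^sup>2 \<le> C\<^sup>2 * (norm (v i (Suc n) - z))\<^sup>2"
proof -
  have "(h i (Suc n))\<^sup>2 / C\<^sup>2 \<le> (norm (v i (Suc n) - z))\<^sup>2"
    using x_step[OF assms(1), of i n] zero_le_power2[of "norm (x i (Suc n) - z)"] by linarith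
  then show ?thesis using assms(2) by (simp add: field_simps)
qed

text \<open>Averaging is convex, the cost step moves a point by at most
  \<open>\<alpha> * norm a\<close>, and the feasibility step never moves away from \<open>z\<close>.
  The bound may grow with \<open>n\<close>, as it serves only integrability.\<close>

lemma iterates_bounded:
  assumes z: "z \<in> X" and R: "\<And>i. norm (x i 0 - z) \<le> R"
  shows "norm (x i n - z) \<le> R + (\<Sum>t<n. \<alpha> (Suc t) * norm a)"
    and "norm (v i (Suc n) - z) \<le> R + (\<Sum>t<Suc n. \<alpha> (Suc t) * norm a)"
proof -
  have v_le: "norm (v i (Suc n) - z) \<le> B + \<alpha> (Suc n) * norm a"
    if "\<And>j. norm (x j n - z) \<le> B" for B i n
  proof -
    have "p i (Suc n) - z = (\<Sum>j\<in>UNIV. w i j *\<^sub>R (x j n - z))"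
      by (simp add: p_eq scaleR_right_diff_distrib sum_subtractf w_rows flip: scaleR_sum_left)
    then have "norm (p i (Suc n) - z) \<le> (\<Sum>j\<in>UNIV. norm (w i j *\<^sub>R (x j n - z)))"
      by (simp only: norm_sum)
    also have "\<dots> \<le> (\<Sum>j\<in>UNIV. w i j * B)"
      by (intro sum_mono) (simp add: w_nonneg mult_left_mono that)
    also have "\<dots> = B" by (simp add: w_rows flip: sum_distrib_right)
    finally show ?thesis
      using norm_v_minus_p[of i n] norm_triangle_ineq[of "v i (Suc n) - p i (Suc n)" "p i (Suc n) - z"]
      by simp
  qed
  have x_le: "norm (x i n - z) \<le> R + (\<Sum>t<n. \<alpha> (Suc t) * norm a)" for i n
  proof (induction n arbitrary: i)
    case (Suc n)
    show ?case
      using norm_x_le_v[OF z, of i n] v_le[OF Suc.IH, of i] by simp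
  qed (simp add: R)
  show "norm (x i n - z) \<le> R + (\<Sum>t<n. \<alpha> (Suc t) * norm a)" by (rule x_le)
  show "norm (v i (Suc n) - z) \<le> R + (\<Sum>t<Suc n. \<alpha> (Suc t) * norm a)"
    using v_le[OF x_le, of i n] by simp
qed

text \<open>The deterministic end of the argument: distances and stepsizes are both square summable,
  so their products are summable and \<open>V_step\<close> is a quasi-Fejer inequality for every
  optimal \<open>z\<close>.\<close>

lemma converges:
  assumes zstar: "zstar \<in> X" "\<And>z. z \<in> X \<Longrightarrow> inner a zstar \<le> inner a z"
    and \<alpha>_div: "filterlim (\<lambda>N. \<Sum>n<N. \<alpha> (Suc n)) at_top sequentially"
    and \<alpha>_sq: "summable (\<lambda>n. (\<alpha> (Suc n))\<^sup>2)"
    and dist_sq: "\<And>i. summable (\<lambda>n. (infdist (v i (Suc n)) X)\<^sup>2)"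
  obtains l where "l \<in> X" "inner a l = inner a zstar" "\<And>i. x i \<longlonglongrightarrow> l"
proof -
  define b where "b n = 3 * (\<alpha> (Suc n) * norm a)\<^sup>2
      + 2 * \<alpha> (Suc n) * norm a * (\<Sum>i\<in>UNIV. \<pi> i * infdist (v i (Suc n)) X)" for n
  define G where "G n = (\<Sum>i\<in>UNIV. \<pi> i * inner a (u i (Suc n) - zstar))" for n
  have G_nonneg: "G n \<ge> 0" for n
    unfolding G_def using zstar(2)[OF u_in] 
    by (intro sum_nonneg mult_nonneg_nonneg less_imp_le[OF \<pi>_pos]) (auto simp: inner_diff)
  have b_nonneg: "b n \<ge> 0" for n
    unfolding b_def
    by (intro add_nonneg_nonneg mult_nonneg_nonneg sum_nonneg \<alpha>_nonneg less_imp_le[OF \<pi>_pos] infdist_nonneg) auto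
  have "summable (\<lambda>n. 3 * (norm a)\<^sup>2 * (\<alpha> (Suc n))\<^sup>2
      + (\<Sum>i\<in>UNIV. (2 * norm a * \<pi> i) * (\<alpha> (Suc n) * infdist (v i (Suc n)) X)))"
    by (intro summable_add summable_mult summable_sum \<alpha>_sq summable_mult_of_squares dist_sq)
  moreover have "b = (\<lambda>n. 3 * (norm a)\<^sup>2 * (\<alpha> (Suc n))\<^sup>2
      + (\<Sum>i\<in>UNIV. (2 * norm a * \<pi> i) * (\<alpha> (Suc n) * infdist (v i (Suc n)) X)))"
    by (auto simp: b_def fun_eq_iff power_mult_distrib sum_distrib_left mult_ac)
  ultimately have b_sum: "summable b" by simp
  \<comment> \<open>All optimal points share one cost value, so the gap \<open>G\<close>, defined
    with \<open>zstar\<close>, serves each of them.\<close>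
  have step: "V z (Suc n) + (T n + 2 * (\<alpha> (Suc n) * G n)) \<le> V z n + b n"
    if "z \<in> X" "inner a z = inner a zstar" for z n
  proof -
    have "(\<Sum>i\<in>UNIV. \<pi> i * (h i (Suc n))\<^sup>2) / C\<^sup>2 \<ge> 0"
      by (intro divide_nonneg_nonneg sum_nonneg mult_nonneg_nonneg less_imp_le[OF \<pi>_pos]) auto
    moreover have "(\<Sum>i\<in>UNIV. \<pi> i * inner a (u i (Suc n) - z)) = G n"
      by (simp add: G_def inner_diff that)
    ultimately show ?thesis using V_step[OF that(1), of n] by (simp add: b_def)
  qed
  have c_nonneg: "T n + 2 * (\<alpha> (Suc n) * G n) \<ge> 0" for n
    by (intro add_nonneg_nonneg T_nonneg mult_nonneg_nonneg \<alpha>_nonneg G_nonneg) auto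
  have V_conv: "convergent (V z)" if "z \<in> X" "inner a z = inner a zstar" for z
    by (rule quasi_fejer(1)[OF step[OF that] V_nonneg c_nonneg b_nonneg b_sum])
  have c_sum: "summable (\<lambda>n. T n + 2 * (\<alpha> (Suc n) * G n))"
    by (rule quasi_fejer(2)[OF step[OF zstar(1) refl] V_nonneg c_nonneg b_nonneg b_sum])
  have T_sum: "summable T"
    by (rule summable_comparison_test'[OF c_sum])
      (use T_nonneg G_nonneg \<alpha>_nonneg in \<open>simp add: T_nonneg\<close>)
  have "summable (\<lambda>n. 2 * (\<alpha> (Suc n) * G n))"
    by (rule summable_comparison_test'[OF c_sum])
      (use T_nonneg G_nonneg \<alpha>_nonneg in \<open>simp add: T_nonneg\<close>)
  then have G_sum: "summable (\<lambda>n. \<alpha> (Suc n) * G n)" by simp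

  \<comment> \<open>Consensus among the agents\<close>
  have x_p: "(\<lambda>n. x j n - p i (Suc n)) \<longlonglongrightarrow> 0" if "w i j > 0" for i j
  proof -
    have le: "\<pi> i * w i j * (norm (x j n - p i (Suc n)))\<^sup>2 \<le> T n" for n
    proof -
      have "\<pi> i * (w i j * (norm (x j n - p i (Suc n)))\<^sup>2)
          \<le> \<pi> i * (\<Sum>j\<in>UNIV. w i j * (norm (x j n - p i (Suc n)))\<^sup>2)"
        using \<pi>_pos by (intro mult_left_mono member_le_sum[of j UNIV "\<lambda>j. w i j * (norm (x j n - p i (Suc n)))\<^sup>2"]) (auto simp: w_nonneg less_imp_le)
      also have "\<dots> \<le> T n" unfolding T_def
        by (rule member_le_sum[of i UNIV "\<lambda>i. \<pi> i * (\<Sum>j\<in>UNIV. w i j * (norm (x j n - p i (Suc n)))\<^sup>2)"])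
          (auto intro!: sum_nonneg mult_nonneg_nonneg w_nonneg less_imp_le[OF \<pi>_pos])
      finally show ?thesis by (simp add: mult.assoc)
    qed
    have "(\<lambda>n. T n / (\<pi> i * w i j)) \<longlonglongrightarrow> 0"
      using summable_LIMSEQ_zero[OF T_sum] by (rule tendsto_divide_zero)
    then have "(\<lambda>n. (norm (x j n - p i (Suc n)))\<^sup>2) \<longlonglongrightarrow> 0"
      by (rule Lim_null_comparison[rotated])
        (use le \<pi>_pos[of i] that in \<open>auto simp: field_simps intro!: always_eventually\<close>)
    then have "(\<lambda>n. sqrt ((norm (x j n - p i (Suc n)))\<^sup>2)) \<longlonglongrightarrow> sqrt 0" by (rule tendsto_real_sqrt)
    then show ?thesis by (simp add: tendsto_norm_zero_iff)
  qed
  \<comment> \<open>Agent \<open>i\<close> gives positive weight to itself and to \<open>j\<close>,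
    so both iterates approach the same average \<open>p i (Suc n)\<close>.\<close>
  have edge: "(\<lambda>n. x i n - x j n) \<longlonglongrightarrow> 0" if "(j, i) \<in> E" for i j
    using tendsto_diff[OF x_p[OF w_self[of i]] x_p[OF w_edge[OF that]]] by simp
  have consensus: "(\<lambda>n. x i n - x j n) \<longlonglongrightarrow> 0" for i j
    using connected[of j i]
  proof (induction rule: rtrancl_induct)
    case (step y z)
    show ?case using tendsto_add[OF edge[OF step.hyps(2)] step.IH] by simp
  qed simp
  have \<alpha>_lim: "(\<lambda>n. \<alpha> (Suc n)) \<longlonglongrightarrow> 0"
    using tendsto_real_sqrt[OF summable_LIMSEQ_zero[OF \<alpha>_sq]] \<alpha>_nonneg by simp
  have p_v: "(\<lambda>n. v i (Suc n) - p i (Suc n)) \<longlonglongrightarrow> 0" for i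
    by (rule Lim_null_comparison[of _ "\<lambda>n. \<alpha> (Suc n) * norm a"])
      (auto intro!: always_eventually norm_v_minus_p tendsto_mult_left_zero[OF \<alpha>_lim])
  have v_u: "(\<lambda>n. v i (Suc n) - u i (Suc n)) \<longlonglongrightarrow> 0" for i
    using tendsto_real_sqrt[OF summable_LIMSEQ_zero[OF dist_sq[of i]]]
    by (simp add: infdist_v tendsto_norm_zero_iff)
  \<comment> \<open>The chain runs through \<open>x j\<close>, \<open>x i\<close>,
    \<open>p i\<close>, \<open>v i\<close>, \<open>u i\<close>, and every link tends to
    zero.\<close>
  have x_u: "(\<lambda>n. x j n - u i (Suc n)) \<longlonglongrightarrow> 0" for i j
    using tendsto_add[OF tendsto_diff[OF
          tendsto_add[OF consensus[of j i] x_p[OF w_self[of i]]] p_v[of i]] v_u[of i]] by simp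

  \<comment> \<open>A common optimal limit point, extracted from the iterates of an arbitrary agent
    \<open>i0\<close>\<close>
  fix i0 :: 'v
  have "\<forall>l. \<exists>n\<ge>l. G n < 1 / real (Suc l)"
    by (intro allI summable_weight_small[OF G_sum \<alpha>_div \<alpha>_nonneg]) simp
  then obtain r where r: "\<And>l. r l \<ge> l" "\<And>l. G (r l) < 1 / real (Suc l)"
    by metis
  \<comment> \<open>The map \<open>r\<close> need not be increasing; \<open>r l \<ge> l\<close> is
    enough for it, and later for \<open>q\<close>, to tend to infinity.\<close>
  have r_top: "filterlim r at_top sequentially"
    using r(1) by (rule filterlim_at_top_mono[OF filterlim_ident always_eventually[OF allI]])
  have G_r: "(\<lambda>l. G (r l)) \<longlonglongrightarrow> 0"
    by (rule Lim_null_comparison[OF _ LIMSEQ_inverse_real_of_nat])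
      (use r(2) G_nonneg in \<open>auto simp: inverse_eq_divide intro!: always_eventually less_imp_le\<close>)
  have x_bdd: "bounded (range (x i0))"
  proof -
    obtain B where B: "\<And>n. V zstar n \<le> B"
      using Bseq_bdd_above[OF convergent_imp_Bseq[OF V_conv[OF zstar(1) refl]]]
      by (auto simp: bdd_above_def)
    have "norm (x i0 n - zstar) \<le> sqrt (B / \<pi> i0)" for n
    proof (rule real_le_rsqrt)
      have "\<pi> i0 * (norm (x i0 n - zstar))\<^sup>2 \<le> V zstar n"
        unfolding V_def by (rule member_le_sum[of i0 UNIV "\<lambda>i. \<pi> i * (norm (x i n - zstar))\<^sup>2"])
          (auto intro!: mult_nonneg_nonneg less_imp_le[OF \<pi>_pos])
      with B[of n] \<pi>_pos[of i0] show "(norm (x i0 n - zstar))\<^sup>2 \<le> B / \<pi> i0"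
        by (simp add: field_simps)
    qed
    then show ?thesis
      by (intro bounded_subset[OF bounded_cball[of zstar "sqrt (B / \<pi> i0)"]])
        (auto simp: dist_norm norm_minus_commute)
  qed
  have "bounded (range (x i0 \<circ> r))"
    by (rule bounded_subset[OF x_bdd]) auto
  then obtain l s where s: "strict_mono s" "((x i0 \<circ> r) \<circ> s) \<longlonglongrightarrow> l"
    using bounded_imp_convergent_subsequence by blast
  define q where "q = r \<circ> s"
  have q_top: "filterlim q at_top sequentially"
    unfolding q_def using filterlim_compose[OF r_top filterlim_subseq[OF s(1)]] by (simp add: o_def)
  have x_q0: "(\<lambda>n. x i0 (q n)) \<longlonglongrightarrow> l" using s(2) by (simp add: q_def o_def)
  have x_q: "(\<lambda>n. x i (q n)) \<longlonglongrightarrow> l" for i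
    using tendsto_add[OF filterlim_compose[OF consensus[of i i0] q_top] x_q0] by simp
  have u_q: "(\<lambda>n. u i (Suc (q n))) \<longlonglongrightarrow> l" for i
    using tendsto_diff[OF x_q[of i] filterlim_compose[OF x_u[of i i] q_top]] by simp
  \<comment> \<open>The feasible points \<open>u\<close> follow the iterates along \<open>q\<close>,
    and \<open>X\<close> is closed.\<close>
  have l_in: "l \<in> X"
    by (rule closed_sequentially[OF X(1) _ u_q]) (rule u_in)
  have "(\<lambda>n. G (q n)) \<longlonglongrightarrow> (\<Sum>i\<in>UNIV. \<pi> i * inner a (l - zstar))"
    unfolding G_def by (intro tendsto_intros u_q)
  moreover have "(\<lambda>n. G (q n)) \<longlonglongrightarrow> 0"
    unfolding q_def using filterlim_compose[OF G_r filterlim_subseq[OF s(1)]] by (simp add: o_def)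
  ultimately have "(\<Sum>i\<in>UNIV. \<pi> i * inner a (l - zstar)) = 0"
    using LIMSEQ_unique by blast
  then have l_opt: "inner a l = inner a zstar"
    by (simp add: \<pi>_sum inner_diff flip: sum_distrib_right)
  \<comment> \<open>Since \<open>l\<close> itself is optimal, \<open>V l\<close> converges along the
    full sequence, and its limit can be read off along \<open>q\<close>.\<close>
  obtain Vlim where V_lim: "V l \<longlonglongrightarrow> Vlim"
    using V_conv[OF l_in l_opt] by (auto simp: convergent_def)
  have "(\<lambda>n. V l (q n)) \<longlonglongrightarrow> (\<Sum>i\<in>UNIV. \<pi> i * (norm (l - l))\<^sup>2)"
    unfolding V_def by (intro tendsto_intros x_q)
  with filterlim_compose[OF V_lim q_top] have "Vlim = 0"
    using LIMSEQ_unique by fastforce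
  with V_lim have V_0: "V l \<longlonglongrightarrow> 0" by simp
  show ?thesis
  proof (rule that[OF l_in l_opt])
    fix i
    have le: "\<pi> i * (norm (x i n - l))\<^sup>2 \<le> V l n" for n
      unfolding V_def by (rule member_le_sum[of i UNIV "\<lambda>i. \<pi> i * (norm (x i n - l))\<^sup>2"])
        (auto intro!: mult_nonneg_nonneg less_imp_le[OF \<pi>_pos])
    have "(\<lambda>n. V l n / \<pi> i) \<longlonglongrightarrow> 0" by (rule tendsto_divide_zero[OF V_0])
    then have "(\<lambda>n. (norm (x i n - l))\<^sup>2) \<longlonglongrightarrow> 0"
      by (rule Lim_null_comparison[rotated])
        (use le \<pi>_pos[of i] in \<open>auto simp: field_simps intro!: always_eventually\<close>)
    then have "(\<lambda>n. sqrt ((norm (x i n - l))\<^sup>2)) \<longlonglongrightarrow> sqrt 0" by (rule tendsto_real_sqrt)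
    then have "(\<lambda>n. x i n - l) \<longlonglongrightarrow> 0" by (simp add: tendsto_norm_zero_iff)
    then show "x i \<longlonglongrightarrow> l" by (simp add: LIM_zero_iff)
  qed
qed

end

section \<open>Expectations and fresh samples\<close>

context prob_space
begin

text \<open>Monotone convergence: a total with finite expectation is finite almost surely.\<close>

lemma AE_summable_of_expectations:
  fixes f :: "nat \<Rightarrow> 'a \<Rightarrow> real"
  assumes int: "\<And>n. integrable M (f n)" and nonneg: "\<And>n \<theta>. f n \<theta> \<ge> 0"
    and sum: "summable (\<lambda>n. expectation (f n))"
  shows "AE \<theta> in M. summable (\<lambda>n. f n \<theta>)"
proof -
  have [measurable]: "f n \<in> borel_measurable M" for n using int by simp
  have "(\<integral>\<^sup>+\<theta>. (\<Sum>n. ennreal (f n \<theta>)) \<partial>M) = (\<Sum>n. \<integral>\<^sup>+\<theta>. ennreal (f n \<theta>) \<partial>M)"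
    by (rule nn_integral_suminf) simp
  also have "\<dots> = (\<Sum>n. ennreal (expectation (f n)))"
    by (intro suminf_cong nn_integral_eq_integral int) (simp add: nonneg)
  also have "\<dots> = ennreal (\<Sum>n. expectation (f n))"
    by (rule suminf_ennreal2[OF _ sum]) (simp add: nonneg)
  finally have "AE \<theta> in M. (\<Sum>n. ennreal (f n \<theta>)) \<noteq> \<infinity>"
    by (intro nn_integral_PInf_AE) auto
  then show ?thesis
    by (rule eventually_mono) (auto intro: summable_suminf_not_top nonneg)
qed

text \<open>Intended for \<open>A\<close> from the initial points, \<open>K\<close> from the past
  samples, \<open>L\<close> from the next one. On the intersection-stable family of sets
  \<open>a \<inter> k\<close>, first \<open>a\<close> is separated from \<open>k \<inter> l\<close>,
  which lies in \<open>B\<close>, and then \<open>k\<close> from \<open>l\<close>.\<close>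

lemma indep_set_sigma_join:
  assumes AB: "indep_set A B" and A: "sigma_algebra (space M) A"
    and K: "sigma_algebra (space M) K" "sigma_algebra (space M) L" "indep_set K L"
    and sub: "\<And>k l. k \<in> K \<Longrightarrow> l \<in> L \<Longrightarrow> k \<in> B \<and> k \<inter> l \<in> B"
    and H: "H \<subseteq> A \<union> K"
  shows "indep_set (sigma_sets (space M) H) L"
proof -
  interpret A: sigma_algebra "space M" A by (rule A)
  interpret K: sigma_algebra "space M" K by (rule K)
  interpret L: sigma_algebra "space M" L by (rule K)
  define G where "G = {a \<inter> k | a k. a \<in> A \<and> k \<in> K}"
  have "indep_set G L"
  proof (rule indep_setI)
    have "A \<subseteq> events" "K \<subseteq> events" using indep_setD_ev1[OF AB] indep_setD_ev1[OF K(3)] by auto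
    then show "G \<subseteq> events" by (auto simp: G_def)
    show "L \<subseteq> events" by (rule indep_setD_ev2[OF K(3)])
    fix b l assume "b \<in> G" and l: "l \<in> L"
    then obtain a k where b: "b = a \<inter> k" "a \<in> A" "k \<in> K" by (auto simp: G_def)
    have "prob (b \<inter> l) = prob (a \<inter> (k \<inter> l))" by (simp add: b Int_assoc)
    also have "\<dots> = prob a * (prob k * prob l)"
      using indep_setD[OF AB b(2), of "k \<inter> l"] sub[OF b(3) l] indep_setD[OF K(3) b(3) l] by simp
    also have "\<dots> = prob b * prob l"
      using indep_setD[OF AB b(2), of k] sub[OF b(3) l] by (simp add: b)
    finally show "prob (b \<inter> l) = prob b * prob l" .
  qed
  moreover have "Int_stable G"
  proof (rule Int_stableI)
    fix b b' assume "b \<in> G" "b' \<in> G"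
    then obtain a k a' k' where *: "b = a \<inter> k" "a \<in> A" "k \<in> K" "b' = a' \<inter> k'" "a' \<in> A" "k' \<in> K"
      by (auto simp: G_def)
    then have "b \<inter> b' = (a \<inter> a') \<inter> (k \<inter> k')" by auto
    with * show "b \<inter> b' \<in> G" unfolding G_def by blast
  qed
  moreover have "Int_stable L" by (auto intro: Int_stableI)
  ultimately have *: "indep_set (sigma_sets (space M) G) (sigma_sets (space M) L)"
    by (rule indep_set_sigma_sets)
  have "H \<subseteq> G"
  proof
    fix b assume "b \<in> H"
    then have "b \<in> A \<or> b \<in> K" using H by auto
    moreover have "b = b \<inter> space M" "b = space M \<inter> b" if "b \<in> A \<or> b \<in> K"
      using that A.sets_into_space K.sets_into_space by auto
    ultimately show "b \<in> G" unfolding G_def using A.top K.top by blast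
  qed
  then show ?thesis
    using * unfolding indep_sets2_eq L.sigma_sets_eq by (meson sigma_sets_mono' subset_iff)
qed

text \<open>Freezing argument: the sample has finitely many values, so the integrand is a finite sum
  of \<open>\<psi> w\<close> times the indicator of \<open>\<xi> \<theta> = w\<close>, and
  independence factorizes each summand.\<close>

lemma expectation_fresh_sample:
  fixes \<psi> :: "'w \<Rightarrow> 'a \<Rightarrow> real" and \<xi> :: "'a \<Rightarrow> 'w"
  assumes F: "space F = space M" "sets F \<subseteq> events"
    and \<xi>: "\<xi> \<in> M \<rightarrow>\<^sub>M count_space UNIV"
    and indep: "indep_set (sets F) {\<xi> -` A \<inter> space M | A. True}"
    and distr: "distr M (count_space UNIV) \<xi> = measure_pmf P"
    and fin: "finite (set_pmf P)" and range: "\<And>\<theta>. \<theta> \<in> space M \<Longrightarrow> \<xi> \<theta> \<in> set_pmf P"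
    and meas: "\<And>w. w \<in> set_pmf P \<Longrightarrow> \<psi> w \<in> borel_measurable F"
    and int: "\<And>w. w \<in> set_pmf P \<Longrightarrow> integrable M (\<psi> w)"
  shows "expectation (\<lambda>\<theta>. \<psi> (\<xi> \<theta>) \<theta>) = expectation (\<lambda>\<theta>. measure_pmf.expectation P (\<lambda>w. \<psi> w \<theta>))"
proof -
  let ?L = "{\<xi> -` A \<inter> space M | A. True}"
  \<comment> \<open>The preimages under \<open>\<xi>\<close> already form a sigma-algebra, so
    generating from them adds nothing.\<close>
  have L: "sigma_sets (space M) L \<subseteq> ?L" if "L \<subseteq> ?L" for L
  proof -
    have "?L = sets (vimage_algebra (space M) \<xi> (count_space UNIV))"
      by (simp add: sets_vimage_algebra2)
    with that sets.sigma_sets_subset[of L "vimage_algebra (space M) \<xi> (count_space UNIV)"]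
    show ?thesis by simp
  qed
  have iv: "indep_var borel (\<psi> w) borel (\<lambda>\<theta>. indicator {w} (\<xi> \<theta>))" if w: "w \<in> set_pmf P" for w
  proof -
    have "{\<psi> w -` A \<inter> space M |A. A \<in> sets borel} \<subseteq> sets F"
      using measurable_sets[OF meas[OF w]] F by auto
    then have "sigma_sets (space M) {\<psi> w -` A \<inter> space M |A. A \<in> sets borel} \<subseteq> sets F"
      using sets.sigma_sets_subset[of _ F] F by simp
    moreover have "(\<lambda>\<theta>. indicator {w} (\<xi> \<theta>) :: real) -` A \<inter> space M \<in> ?L" for A
    proof -
      have "(\<lambda>\<theta>. indicator {w} (\<xi> \<theta>) :: real) -` A \<inter> space M = \<xi> -` ((indicator {w} :: 'w \<Rightarrow> real) -` A) \<inter> space M"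
        by auto
      then show ?thesis by blast
    qed
    then have "sigma_sets (space M) {(\<lambda>\<theta>. indicator {w} (\<xi> \<theta>) :: real) -` A \<inter> space M |A. A \<in> sets borel} \<subseteq> ?L"
      by (intro L) auto
    moreover have "\<psi> w \<in> borel_measurable M" using int[OF w] by simp
    moreover have "(\<lambda>\<theta>. indicator {w} (\<xi> \<theta>) :: real) \<in> borel_measurable M"
      by (rule measurable_compose[OF \<xi>]) simp
    ultimately show ?thesis
      using indep unfolding indep_var_eq indep_sets2_eq by (meson subset_iff)
  qed
  have [measurable]: "\<xi> \<in> M \<rightarrow>\<^sub>M count_space UNIV" by (rule \<xi>)
  have ind_int: "integrable M (\<lambda>\<theta>. indicator {w} (\<xi> \<theta>) :: real)" for w
    by (rule integrable_const_bound[of _ 1]) (auto simp: indicator_def)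
  have ind_E: "expectation (\<lambda>\<theta>. indicator {w} (\<xi> \<theta>) :: real) = pmf P w" for w
  proof -
    have "expectation (\<lambda>\<theta>. indicator {w} (\<xi> \<theta>) :: real)
      = integral\<^sup>L (distr M (count_space UNIV) \<xi>) (indicator {w} :: 'w \<Rightarrow> real)"
      by (rule integral_distr[symmetric]) auto
    then show ?thesis by (simp add: distr measure_pmf_single)
  qed
  have "expectation (\<lambda>\<theta>. \<psi> (\<xi> \<theta>) \<theta>)
    = expectation (\<lambda>\<theta>. \<Sum>w\<in>set_pmf P. \<psi> w \<theta> * indicator {w} (\<xi> \<theta>))"
    by (rule Bochner_Integration.integral_cong[OF refl])
      (use fin range in \<open>simp add: indicator_def if_distrib sum.delta cong: if_cong\<close>)
  also have "\<dots> = (\<Sum>w\<in>set_pmf P. expectation (\<lambda>\<theta>. \<psi> w \<theta> * indicator {w} (\<xi> \<theta>)))"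
    by (intro Bochner_Integration.integral_sum indep_var_integrable iv int ind_int)
  also have "\<dots> = (\<Sum>w\<in>set_pmf P. expectation (\<psi> w) * pmf P w)"
    by (intro sum.cong refl) (simp add: indep_var_lebesgue_integral[OF iv int ind_int] ind_E)
  also have "\<dots> = expectation (\<lambda>\<theta>. \<Sum>w\<in>set_pmf P. \<psi> w \<theta> * pmf P w)"
    using int by simp
  also have "\<dots> = expectation (\<lambda>\<theta>. measure_pmf.expectation P (\<lambda>w. \<psi> w \<theta>))"
    by (simp add: integral_measure_pmf_real[OF fin])
  finally show ?thesis .
qed

text \<open>No moments of the initial points are available, so expectations are taken on the events that
  all of them lie within distance \<open>R\<close> of \<open>z\<close>; there every iterate is bounded, by a constant
  that depends on \<open>n\<close>.\<close>

lemma AE_summable_infdist: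
  fixes X0 X :: "'b::euclidean_space set" and x :: "'v::finite \<Rightarrow> nat \<Rightarrow> 'a \<Rightarrow> 'b"
  assumes path: "\<And>\<theta>. \<theta> \<in> space M \<Longrightarrow> dap_path X0 X a E w \<pi> \<alpha> C (\<lambda>i n. h i n \<theta>)
      (\<lambda>i n. p i n \<theta>) (\<lambda>i n. v i n \<theta>) (\<lambda>i n. x i n \<theta>)"
    and x_meas: "\<And>i n. x i n \<in> borel_measurable M"
    and v_meas: "\<And>i n. v i (Suc n) \<in> borel_measurable M"
    and h_meas: "\<And>i n. h i (Suc n) \<in> borel_measurable M"
    and z: "z \<in> X" "\<And>y. y \<in> X \<Longrightarrow> inner a z \<le> inner a y"
    and C: "C > 0" and c: "c > 0"
    and \<alpha>_sq: "summable (\<lambda>n. (\<alpha> (Suc n))\<^sup>2)"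
    and reg: "\<And>R i n. expectation (\<lambda>\<theta>. indicator {\<theta>. \<forall>j. norm (x j 0 \<theta> - z) \<le> R} \<theta> * (infdist (v i (Suc n) \<theta>) X)\<^sup>2)
      \<le> c * expectation (\<lambda>\<theta>. indicator {\<theta>. \<forall>j. norm (x j 0 \<theta> - z) \<le> R} \<theta> * (h i (Suc n) \<theta>)\<^sup>2)"
  shows "AE \<theta> in M. \<forall>i. summable (\<lambda>n. (infdist (v i (Suc n) \<theta>) X)\<^sup>2)"
proof -
  \<comment> \<open>Any one realization gives access to the facts about \<open>\<pi>\<close>, which
    do not depend on it.\<close>
  obtain \<theta>0 where \<theta>0: "\<theta>0 \<in> space M" using not_empty by auto
  interpret P0: dap_path X0 X a E w \<pi> \<alpha> C "\<lambda>i n. h i n \<theta>0"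
      "\<lambda>i n. p i n \<theta>0" "\<lambda>i n. v i n \<theta>0" "\<lambda>i n. x i n \<theta>0" by (rule path[OF \<theta>0])
  note [measurable] = x_meas v_meas h_meas
  have AE_R: "AE \<theta> in M. (\<forall>j. norm (x j 0 \<theta> - z) \<le> R) \<longrightarrow> (\<forall>i. summable (\<lambda>n. (infdist (v i (Suc n) \<theta>) X)\<^sup>2))" for R
  proof -
    define I :: "'a \<Rightarrow> real" where "I = indicator {\<theta>. \<forall>j. norm (x j 0 \<theta> - z) \<le> R}"
    have [measurable]: "I \<in> borel_measurable M"
      unfolding I_def by measurable
    have I_1: "norm (x j 0 \<theta> - z) \<le> R" if "I \<theta> \<noteq> 0" for j \<theta>
      using that by (auto simp: I_def indicator_def split: if_splits)
    have I_01: "I \<theta> = 0 \<or> I \<theta> = 1" for \<theta> by (auto simp: I_def indicator_def)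
    have integrable_I: "integrable M (\<lambda>\<theta>. I \<theta> * f \<theta>)"
      if "f \<in> borel_measurable M" "\<And>\<theta>. \<theta> \<in> space M \<Longrightarrow> I \<theta> \<noteq> 0 \<Longrightarrow> 0 \<le> f \<theta> \<and> f \<theta> \<le> K" for f K
    proof (rule integrable_const_bound[of _ "\<bar>K\<bar>"])
      show "AE \<theta> in M. norm (I \<theta> * f \<theta>) \<le> \<bar>K\<bar>"
      proof (rule AE_I2)
        show "norm (I \<theta> * f \<theta>) \<le> \<bar>K\<bar>" if "\<theta> \<in> space M" for \<theta>
          using I_01[of \<theta>] \<open>\<And>\<theta>. \<theta> \<in> space M \<Longrightarrow> I \<theta> \<noteq> 0 \<Longrightarrow> 0 \<le> f \<theta> \<and> f \<theta> \<le> K\<close>[OF that] by auto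
      qed
    qed (use that(1) in measurable)
    define B where "B n = R + (\<Sum>t<n. \<alpha> (Suc t) * norm a)" for n
    have x_le: "(norm (x i n \<theta> - z))\<^sup>2 \<le> (B n)\<^sup>2" and v_le: "(norm (v i (Suc n) \<theta> - z))\<^sup>2 \<le> (B (Suc n))\<^sup>2"
      if "\<theta> \<in> space M" "I \<theta> \<noteq> 0" for \<theta> i n
      using dap_path.iterates_bounded[OF path[OF that(1)] z(1) I_1[OF that(2)]]
      by (auto simp: B_def intro!: power_mono)
    have e_le: "(infdist (v i (Suc n) \<theta>) X)\<^sup>2 \<le> (norm (v i (Suc n) \<theta> - z))\<^sup>2" for i n \<theta>
      using infdist_le[OF z(1), of "v i (Suc n) \<theta>"] by (simp add: dist_norm power_mono infdist_nonneg)
    have [measurable]: "(\<lambda>\<theta>. infdist (v i (Suc n) \<theta>) X) \<in> borel_measurable M" for i n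
      by (intro borel_measurable_continuous_on[OF _ v_meas] continuous_intros)
    have int_x: "integrable M (\<lambda>\<theta>. I \<theta> * (norm (x i n \<theta> - z))\<^sup>2)" for i n
      by (rule integrable_I[of _ "(B n)\<^sup>2"]) (use x_le in auto)
    have int_e: "integrable M (\<lambda>\<theta>. I \<theta> * (infdist (v i (Suc n) \<theta>) X)\<^sup>2)" for i n
      by (rule integrable_I[of _ "(B (Suc n))\<^sup>2"]) (use order.trans[OF e_le v_le] in auto)
    have int_h: "integrable M (\<lambda>\<theta>. I \<theta> * (h i (Suc n) \<theta>)\<^sup>2)" for i n
    proof (rule integrable_I[of _ "C\<^sup>2 * (B (Suc n))\<^sup>2"])
      fix \<theta> assume *: "\<theta> \<in> space M" "I \<theta> \<noteq> 0"
      have "(h i (Suc n) \<theta>)\<^sup>2 \<le> C\<^sup>2 * (norm (v i (Suc n) \<theta> - z))\<^sup>2"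
        by (rule dap_path.h_le[OF path[OF *(1)] z(1) C])
      also have "\<dots> \<le> C\<^sup>2 * (B (Suc n))\<^sup>2" by (intro mult_left_mono v_le *) auto
      finally show "0 \<le> (h i (Suc n) \<theta>)\<^sup>2 \<and> (h i (Suc n) \<theta>)\<^sup>2 \<le> C\<^sup>2 * (B (Suc n))\<^sup>2" by simp
    qed measurable
    define EV where "EV n = (\<Sum>i\<in>UNIV. \<pi> i * expectation (\<lambda>\<theta>. I \<theta> * (norm (x i n \<theta> - z))\<^sup>2))" for n
    define Ee where "Ee n = (\<Sum>i\<in>UNIV. \<pi> i * expectation (\<lambda>\<theta>. I \<theta> * (infdist (v i (Suc n) \<theta>) X)\<^sup>2))" for n
    define Eh where "Eh n = (\<Sum>i\<in>UNIV. \<pi> i * expectation (\<lambda>\<theta>. I \<theta> * (h i (Suc n) \<theta>)\<^sup>2))" for n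
    \<comment> \<open>Regularity gives \<open>Ee n \<le> c * Eh n\<close>, so with this value
      \<open>2 * \<eta> * Ee n \<le> Eh n / C\<^sup>2\<close>: one half pays for the Young term, the
      other half remains to be summed.\<close>
    define \<eta> where "\<eta> = 1 / (2 * c * C\<^sup>2)"
    have \<eta>: "\<eta> > 0" using c C by (simp add: \<eta>_def)
    define b where "b n = (3 + 1 / \<eta>) * (\<alpha> (Suc n) * norm a)\<^sup>2" for n
    have b: "b n \<ge> 0" for n using \<eta> by (simp add: b_def)
    have E_sum: "expectation (\<lambda>\<theta>. I \<theta> * (\<Sum>i\<in>UNIV. \<pi> i * f i \<theta>)) = (\<Sum>i\<in>UNIV. \<pi> i * expectation (\<lambda>\<theta>. I \<theta> * f i \<theta>))"
      "integrable M (\<lambda>\<theta>. I \<theta> * (\<Sum>i\<in>UNIV. \<pi> i * f i \<theta>))"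
      if "\<And>i. integrable M (\<lambda>\<theta>. I \<theta> * f i \<theta>)" for f
    proof -
      have "(\<lambda>\<theta>. I \<theta> * (\<Sum>i\<in>UNIV. \<pi> i * f i \<theta>)) = (\<lambda>\<theta>. \<Sum>i\<in>UNIV. \<pi> i * (I \<theta> * f i \<theta>))"
        by (simp add: sum_distrib_left mult_ac)
      then show "expectation (\<lambda>\<theta>. I \<theta> * (\<Sum>i\<in>UNIV. \<pi> i * f i \<theta>)) = (\<Sum>i\<in>UNIV. \<pi> i * expectation (\<lambda>\<theta>. I \<theta> * f i \<theta>))"
        "integrable M (\<lambda>\<theta>. I \<theta> * (\<Sum>i\<in>UNIV. \<pi> i * f i \<theta>))"
        using that by simp_all
    qed
    note E_x = E_sum[of "\<lambda>i \<theta>. (norm (x i _ \<theta> - z))\<^sup>2", OF int_x]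
    note E_e = E_sum[of "\<lambda>i \<theta>. (infdist (v i (Suc _) \<theta>) X)\<^sup>2", OF int_e]
    note E_h = E_sum[of "\<lambda>i \<theta>. (h i (Suc _) \<theta>)\<^sup>2", OF int_h]
    have I_int: "integrable M (\<lambda>\<theta>. I \<theta> * b n)" for n
      by (rule integrable_I[of _ "b n"]) (use b in auto)
    have step: "EV (Suc n) + \<eta> * Ee n \<le> EV n + b n" for n
    proof -
      have "expectation (\<lambda>\<theta>. I \<theta> * (\<Sum>i\<in>UNIV. \<pi> i * (norm (x i (Suc n) \<theta> - z))\<^sup>2)
          + (I \<theta> * (\<Sum>i\<in>UNIV. \<pi> i * (h i (Suc n) \<theta>)\<^sup>2)) / C\<^sup>2)
        \<le> expectation (\<lambda>\<theta>. I \<theta> * (\<Sum>i\<in>UNIV. \<pi> i * (norm (x i n \<theta> - z))\<^sup>2) + I \<theta> * b n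
          + \<eta> * (I \<theta> * (\<Sum>i\<in>UNIV. \<pi> i * (infdist (v i (Suc n) \<theta>) X)\<^sup>2)))"
      proof (rule integral_mono)
        fix \<theta> assume "\<theta> \<in> space M"
        from dap_path.V_descent[OF path[OF this] z \<eta>, of n]
        show "I \<theta> * (\<Sum>i\<in>UNIV. \<pi> i * (norm (x i (Suc n) \<theta> - z))\<^sup>2)
            + (I \<theta> * (\<Sum>i\<in>UNIV. \<pi> i * (h i (Suc n) \<theta>)\<^sup>2)) / C\<^sup>2
          \<le> I \<theta> * (\<Sum>i\<in>UNIV. \<pi> i * (norm (x i n \<theta> - z))\<^sup>2) + I \<theta> * b n
            + \<eta> * (I \<theta> * (\<Sum>i\<in>UNIV. \<pi> i * (infdist (v i (Suc n) \<theta>) X)\<^sup>2))"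
          using I_01[of \<theta>] by (auto simp: b_def)
      qed (intro Bochner_Integration.integrable_add integrable_divide_zero integrable_mult_right E_x E_e E_h I_int)+
      moreover have "expectation (\<lambda>\<theta>. I \<theta> * (\<Sum>i\<in>UNIV. \<pi> i * (norm (x i (Suc n) \<theta> - z))\<^sup>2)
          + (I \<theta> * (\<Sum>i\<in>UNIV. \<pi> i * (h i (Suc n) \<theta>)\<^sup>2)) / C\<^sup>2) = EV (Suc n) + Eh n / C\<^sup>2"
        by (simp add: E_x E_h EV_def Eh_def)
      moreover have "expectation (\<lambda>\<theta>. I \<theta> * (\<Sum>i\<in>UNIV. \<pi> i * (norm (x i n \<theta> - z))\<^sup>2) + I \<theta> * b n
          + \<eta> * (I \<theta> * (\<Sum>i\<in>UNIV. \<pi> i * (infdist (v i (Suc n) \<theta>) X)\<^sup>2)))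
          = EV n + expectation (\<lambda>\<theta>. I \<theta> * b n) + \<eta> * Ee n"
        using E_x E_e I_int by (simp add: EV_def Ee_def)
      moreover have "expectation (\<lambda>\<theta>. I \<theta> * b n) \<le> expectation (\<lambda>\<theta>. b n)"
      proof (intro integral_mono I_int)
        show "I \<theta> * b n \<le> b n" for \<theta> using I_01[of \<theta>] b[of n] by auto
      qed simp
      moreover have "2 * \<eta> * Ee n \<le> Eh n / C\<^sup>2"
      proof -
        have "Ee n \<le> (\<Sum>i\<in>UNIV. \<pi> i * (c * expectation (\<lambda>\<theta>. I \<theta> * (h i (Suc n) \<theta>)\<^sup>2)))"
          unfolding Ee_def I_def by (intro sum_mono mult_left_mono reg less_imp_le[OF P0.\<pi>_pos])
        also have "\<dots> = c * Eh n" by (simp add: Eh_def sum_distrib_left mult_ac)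
        finally have "2 * \<eta> * Ee n \<le> 2 * \<eta> * (c * Eh n)" using \<eta> by (intro mult_left_mono) auto
        also have "\<dots> = Eh n / C\<^sup>2" using c C by (simp add: \<eta>_def)
        finally show ?thesis .
      qed
      ultimately show ?thesis by (simp add: prob_space)
    qed
    have I_nonneg: "I \<theta> \<ge> 0" for \<theta> using I_01[of \<theta>] by auto
    have E_nonneg: "EV n \<ge> 0" "Ee n \<ge> 0" for n
      unfolding EV_def Ee_def
      by (auto intro!: sum_nonneg mult_nonneg_nonneg integral_nonneg_AE AE_I2 I_nonneg less_imp_le[OF P0.\<pi>_pos])
    have "summable b"
      unfolding b_def power_mult_distrib by (intro summable_mult summable_mult2 \<alpha>_sq)
    with E_nonneg \<eta> have sum_Ee: "summable (\<lambda>n. \<eta> * Ee n)"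
      by (intro quasi_fejer(2)[of EV, OF step]) (auto simp: b)
    have "AE \<theta> in M. summable (\<lambda>n. I \<theta> * (infdist (v i (Suc n) \<theta>) X)\<^sup>2)" for i
    proof (rule AE_summable_of_expectations[OF int_e])
      show "summable (\<lambda>n. expectation (\<lambda>\<theta>. I \<theta> * (infdist (v i (Suc n) \<theta>) X)\<^sup>2))"
      proof (rule summable_comparison_test'[OF summable_mult[OF sum_Ee, of "1 / (\<eta> * \<pi> i)"]])
        fix n
        have nn: "expectation (\<lambda>\<theta>. I \<theta> * (infdist (v j (Suc n) \<theta>) X)\<^sup>2) \<ge> 0" for j
          by (auto intro!: mult_nonneg_nonneg integral_nonneg_AE AE_I2 I_nonneg)
        have "\<pi> i * expectation (\<lambda>\<theta>. I \<theta> * (infdist (v i (Suc n) \<theta>) X)\<^sup>2) \<le> Ee n"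
          unfolding Ee_def
          by (rule member_le_sum[of i UNIV "\<lambda>i. \<pi> i * expectation (\<lambda>\<theta>. I \<theta> * (infdist (v i (Suc n) \<theta>) X)\<^sup>2)"])
            (auto intro!: mult_nonneg_nonneg less_imp_le[OF P0.\<pi>_pos] nn)
        then show "norm (expectation (\<lambda>\<theta>. I \<theta> * (infdist (v i (Suc n) \<theta>) X)\<^sup>2)) \<le> 1 / (\<eta> * \<pi> i) * (\<eta> * Ee n)"
          using \<eta> P0.\<pi>_pos[of i] nn by (simp add: field_simps)
      qed
    qed (simp add: I_nonneg)
    then have "AE \<theta> in M. \<forall>i. summable (\<lambda>n. I \<theta> * (infdist (v i (Suc n) \<theta>) X)\<^sup>2)"
      unfolding AE_all_countable by blast
    then show ?thesis
      by (rule eventually_mono) (auto simp: I_def)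
  qed
  \<comment> \<open>There are finitely many agents, so the events with integer radius cover the
    space and only countably many null sets are discarded.\<close>
  have "AE \<theta> in M. \<forall>m. (\<forall>j. norm (x j 0 \<theta> - z) \<le> real m) \<longrightarrow> (\<forall>i. summable (\<lambda>n. (infdist (v i (Suc n) \<theta>) X)\<^sup>2))"
    unfolding AE_all_countable by (intro allI AE_R)
  then show ?thesis
  proof (rule eventually_mono)
    fix \<theta> assume *: "\<forall>m. (\<forall>j. norm (x j 0 \<theta> - z) \<le> real m) \<longrightarrow> (\<forall>i. summable (\<lambda>n. (infdist (v i (Suc n) \<theta>) X)\<^sup>2))"
    obtain m where m: "(\<Sum>j\<in>UNIV. norm (x j 0 \<theta> - z)) \<le> real m" using real_arch_simple by blast
    have "norm (x j 0 \<theta> - z) \<le> real m" for j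
      by (rule order.trans[OF member_le_sum[of j UNIV "\<lambda>j. norm (x j 0 \<theta> - z)"] m]) auto
    with * show "\<forall>i. summable (\<lambda>n. (infdist (v i (Suc n) \<theta>) X)\<^sup>2)" by blast
  qed
qed

end

section \<open>The history and its independence of the next sample\<close>

lemma space_history [simp]: "space (history M x0 \<omega> k) = space M"
  by (simp add: history_def space_measure_of_conv)

lemma sets_history:
  "sets (history M x0 \<omega> k) = sigma_sets (space M)
     ({x0 i -` A \<inter> space M | i A. A \<in> sets borel} \<union> sample_events M \<omega> {1..k})"
  unfolding history_def by (rule sets_measure_of) (auto simp: sample_events_def)

lemma sample_events_mono: "K \<subseteq> L \<Longrightarrow> sample_events M \<omega> K \<subseteq> sample_events M \<omega> L"
  unfolding sample_events_def by blast

lemma sample_eventsI: "t \<in> K \<Longrightarrow> \<omega> i t -` A \<inter> space M \<in> sample_events M \<omega> K"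
  unfolding sample_events_def by blast

lemma sets_history_mono: "k \<le> l \<Longrightarrow> sets (history M x0 \<omega> k) \<subseteq> sets (history M x0 \<omega> l)"
  unfolding sets_history by (intro sigma_sets_mono' Un_mono order_refl sample_events_mono) auto

lemma measurable_history_mono:
  assumes "f \<in> history M x0 \<omega> k \<rightarrow>\<^sub>M N" "k \<le> l" shows "f \<in> history M x0 \<omega> l \<rightarrow>\<^sub>M N"
proof (rule measurableI)
  show "f \<theta> \<in> space N" if "\<theta> \<in> space (history M x0 \<omega> l)" for \<theta>
    using measurable_space[OF assms(1)] that by simp
  show "f -` A \<inter> space (history M x0 \<omega> l) \<in> sets (history M x0 \<omega> l)" if "A \<in> sets N" for A
    using measurable_sets[OF assms(1) that] sets_history_mono[OF assms(2), of M x0 \<omega>] by auto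
qed

lemma initial_measurable_history: "x0 i \<in> borel_measurable (history M x0 \<omega> k)"
  by (rule measurableI) (auto simp: sets_history intro!: sigma_sets.Basic)

text \<open>The codomain is cut down to \<open>S\<close> so that, for finite \<open>S\<close>,
  measurability of sample-dependent quantities can be checked value by value.\<close>

lemma sample_measurable_history:
  assumes "1 \<le> t" "t \<le> k" "\<And>\<theta>. \<theta> \<in> space M \<Longrightarrow> \<omega> i t \<theta> \<in> S"
  shows "\<omega> i t \<in> history M x0 \<omega> k \<rightarrow>\<^sub>M count_space S"
  by (rule measurableI) (use assms in \<open>auto simp: sets_history intro!: sigma_sets.Basic UnI2 sample_eventsI\<close>)

lemma (in prob_space) sets_history_subset_events:
  assumes "\<And>i. x0 i \<in> borel_measurable M" "\<And>i t. t \<ge> 1 \<Longrightarrow> \<omega> i t \<in> M \<rightarrow>\<^sub>M count_space UNIV"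
  shows "sets (history M x0 \<omega> k) \<subseteq> events"
  unfolding sets_history using assms
  by (intro sets.sigma_sets_subset) (auto simp: sample_events_def intro!: measurable_sets)

text \<open>Grouping the samples separates those of all agents up to time \<open>k\<close> from the
  next one of agent \<open>i\<close>; \<open>indep_set_sigma_join\<close> then adds the initial
  points.\<close>

lemma (in prob_space) indep_history_sample:
  fixes \<omega> :: "'v \<Rightarrow> nat \<Rightarrow> 'a \<Rightarrow> 'w"
  assumes samples: "indep_vars (\<lambda>(i, k). count_space (\<Omega> i)) (\<lambda>(i, k). \<omega> i k) (UNIV \<times> {1..})"
    and init: "indep_set (sets (history M x0 \<omega> 0)) (sigma_sets (space M) (sample_events M \<omega> {1..}))"
  shows "indep_set (sets (history M x0 \<omega> k)) {\<omega> i (Suc k) -` A \<inter> space M | A. True}" (is "indep_set _ ?L")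
proof -
  define \<E> where "\<E> = (\<lambda>(i, t). {\<omega> i t -` A \<inter> space M | A. A \<in> sets (count_space (\<Omega> i))})"
  \<comment> \<open>Samples lie in \<open>\<Omega> i\<close>, so an arbitrary \<open>A\<close> may
    be replaced by \<open>A \<inter> \<Omega> i\<close>, to which the given independence
    applies.\<close>
  have \<E>: "\<omega> i t -` A \<inter> space M \<in> \<E> (i, t)" if "t \<ge> 1" for i t A
  proof -
    have "\<omega> i t \<in> M \<rightarrow>\<^sub>M count_space (\<Omega> i)" using samples that by (auto simp: indep_vars_def)
    then have "\<omega> i t -` A \<inter> space M = \<omega> i t -` (A \<inter> \<Omega> i) \<inter> space M"
      by (auto dest: measurable_space)
    then show ?thesis unfolding \<E>_def by (simp only: prod.case sets_count_space) blast
  qed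
  define I where "I b = (if b then UNIV \<times> {1..k} else {(i, Suc k)})" for b
  have "indep_sets (\<lambda>b. sigma_sets (space M) (\<Union>j\<in>I b. \<E> j)) UNIV"
  proof (rule indep_sets_collect_sigma)
    have "indep_sets \<E> (UNIV \<times> {1..})"
      using samples unfolding indep_vars_def2 \<E>_def by (simp add: case_prod_unfold)
    then show "indep_sets \<E> (\<Union>b\<in>UNIV. I b)"
      by (rule indep_sets_mono_index[rotated]) (auto simp: I_def split: if_splits)
    show "Int_stable (\<E> j)" for j
    proof (rule Int_stableI)
      fix a b assume "a \<in> \<E> j" "b \<in> \<E> j"
      then obtain A B where "A \<subseteq> \<Omega> (fst j)" "B \<subseteq> \<Omega> (fst j)"
        "a = \<omega> (fst j) (snd j) -` A \<inter> space M" "b = \<omega> (fst j) (snd j) -` B \<inter> space M"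
        by (auto simp: \<E>_def case_prod_unfold)
      then show "a \<inter> b \<in> \<E> j"
        by (auto simp: \<E>_def case_prod_unfold intro!: exI[of _ "A \<inter> B"])
    qed
    show "disjoint_family_on I UNIV" by (auto simp: disjoint_family_on_def I_def)
  qed
  then have ind: "indep_set (sigma_sets (space M) (\<Union>j\<in>I True. \<E> j)) (sigma_sets (space M) (\<Union>j\<in>I False. \<E> j))"
    unfolding indep_set_def
    by (rule indep_sets_mono_sets) (auto split: bool.split)
  have L: "?L = sets (vimage_algebra (space M) (\<omega> i (Suc k)) (count_space UNIV))"
    by (simp add: sets_vimage_algebra2)
  let ?K = "sigma_sets (space M) (sample_events M \<omega> {1..k})"
  let ?B = "sigma_sets (space M) (sample_events M \<omega> {1..})"
  have sub: "sample_events M \<omega> {1..k} \<subseteq> (\<Union>j\<in>I True. \<E> j)" "?L \<subseteq> (\<Union>j\<in>I False. \<E> j)"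
    using \<E> by (auto simp: sample_events_def I_def intro!: exI bexI)
  have "?L \<subseteq> sigma_sets (space M) (\<Union>j\<in>I False. \<E> j)"
    by (rule order.trans[OF sub(2)]) (rule sigma_sets_superset_generator)
  with ind sigma_sets_mono'[OF sub(1), of "space M"] have "indep_set ?K ?L"
    unfolding indep_sets2_eq by blast
  have sigB: "sigma_algebra (space M) ?B" and sigK: "sigma_algebra (space M) ?K"
    by (auto intro!: sigma_algebra_sigma_sets simp: sample_events_def)
  show ?thesis
    unfolding sets_history[of M x0 \<omega> k]
  proof (rule indep_set_sigma_join[OF init _ sigK _ \<open>indep_set ?K ?L\<close>])
    show "sigma_algebra (space M) (sets (history M x0 \<omega> 0))"
      using sets.sigma_algebra_axioms[of "history M x0 \<omega> 0"] by simp
    show "sigma_algebra (space M) ?L"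
      unfolding L using sets.sigma_algebra_axioms[of "vimage_algebra (space M) (\<omega> i (Suc k)) (count_space UNIV)"] by simp
    show "a \<in> ?B \<and> a \<inter> l \<in> ?B" if "a \<in> ?K" "l \<in> ?L" for a l
    proof -
      interpret B: sigma_algebra "space M" ?B by (rule sigB)
      have "a \<in> ?B" using that(1) sigma_sets_mono'[OF sample_events_mono[of "{1..k}" "{1..}" M \<omega>], of "space M"] by auto
      moreover have "l \<in> ?B" using that(2) by (auto intro!: sigma_sets.Basic sample_eventsI)
      ultimately show ?thesis by (intro conjI B.Int)
    qed
    show "{x0 i -` A \<inter> space M | i A. A \<in> sets borel} \<union> sample_events M \<omega> {1..k}
        \<subseteq> sets (history M x0 \<omega> 0) \<union> ?K"
      by (auto simp: sets_history intro!: sigma_sets.Basic)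
  qed
qed

section \<open>Almost sure convergence\<close>

theorem proposition2:
  fixes E :: "('v::finite \<times> 'v) set"
    and Y0 :: "(real ^ 'n) set"
    and f :: "'v \<Rightarrow> real ^ 'n \<Rightarrow> real"
    and Df :: "'v \<Rightarrow> (real ^ 'n) set"
    and \<Omega> :: "'v \<Rightarrow> 'w set"
    and g :: "(real ^ 'n) \<times> (real ^ 'v) \<Rightarrow> 'w \<Rightarrow> real"
    and Dg :: "'w \<Rightarrow> ((real ^ 'n) \<times> (real ^ 'v)) set"
    and M :: "'a measure"
    and P :: "'v \<Rightarrow> 'w pmf"
    and \<omega> :: "'v \<Rightarrow> nat \<Rightarrow> 'a \<Rightarrow> 'w"
    and \<alpha> :: "nat \<Rightarrow> real"
    and dfix :: "'v \<Rightarrow> (real ^ 'n) \<times> (real ^ 'v)"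
    and d p v x :: "'v \<Rightarrow> nat \<Rightarrow> 'a \<Rightarrow> (real ^ 'n) \<times> (real ^ 'v)"
  defines "X0 \<equiv> Y0 \<times> (UNIV :: (real ^ 'v) set)"
  defines "X \<equiv> feasible_set X0 \<Omega> g"
  defines "Xstar \<equiv> argmin_set (\<lambda>z. inner epi_cost z) X"
  \<comment> \<open>constraint structure of the epigraph problem\<close>
  assumes Omega_finite: "\<And>i. finite (\<Omega> i)"
    and g_form: "\<And>i w. w \<in> \<Omega> i \<Longrightarrow>
          is_orig_constraint (\<lambda>z. g z w) \<or> (\<exists>j. is_epi_constraint (f j) j (\<lambda>z. g z w))"
    and own_epi: "\<And>i. \<exists>w\<in>\<Omega> i. is_epi_constraint (f i) i (\<lambda>z. g z w)"
  \<comment> \<open>(B2)\<close>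
    and Y0: "Y0 \<noteq> {}" "closed Y0" "convex Y0"
    and f_convex: "\<And>i. open (Df i) \<and> Y0 \<subseteq> Df i \<and> convex_on (Df i) (f i)"
    and f_subgrad: "\<And>i. \<exists>C. \<forall>y\<in>Y0. \<forall>u\<in>subdifferential (Df i) (f i) y. norm u \<le> C"
    and g_convex: "\<And>i w. w \<in> \<Omega> i \<Longrightarrow>
          open (Dg w) \<and> X0 \<subseteq> Dg w \<and> convex_on (Dg w) (\<lambda>z. g z w)"
    and g_subgrad: "\<exists>Cg. \<forall>i. \<forall>w\<in>\<Omega> i. \<forall>z\<in>X0.
          \<forall>u\<in>subdifferential (Dg w) (\<lambda>z. pos_part g z w) z. norm u \<le> Cg"
  \<comment> \<open>(B3)\<close>
    and M: "prob_space M"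
    and samples_indep: "prob_space.indep_vars M (\<lambda>(i, k). count_space (\<Omega> i)) (\<lambda>(i, k). \<omega> i k)
          (UNIV \<times> {1..})"
    and samples_distr: "\<And>i k. k \<ge> 1 \<Longrightarrow> distr M (count_space UNIV) (\<omega> i k) = measure_pmf (P i)"
    and samples_support: "\<And>i. set_pmf (P i) = \<Omega> i"
  \<comment> \<open>(B4)\<close>
    and regularity: "\<And>i. \<exists>c>0. \<forall>z\<in>X0.
          (infdist z X)\<^sup>2 \<le> c * measure_pmf.expectation (P i) (\<lambda>w. (pos_part g z w)\<^sup>2)"
  \<comment> \<open>optimal set, network, stepsizes\<close>
    and Xstar_nonempty: "Xstar \<noteq> {}"
    and strongly_connected: "\<And>i j. (i, j) \<in> E\<^sup>*"
    and alpha_nonneg: "\<And>k. k \<ge> 1 \<Longrightarrow> \<alpha> k \<ge> 0"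
    and alpha_mono: "antimono_on {1..} \<alpha>"
    and alpha_sum: "filterlim (\<lambda>K. \<Sum>k=1..K. \<alpha> k) at_top sequentially"
    and alpha_square_sum: "summable (\<lambda>k. (\<alpha> (Suc k))\<^sup>2)"
  \<comment> \<open>iterates\<close>
    and x_init_measurable: "\<And>i. x i 0 \<in> borel_measurable M"
    and x_init_indep: "prob_space.indep_set M (sets (history M (\<lambda>i. x i 0) \<omega> 0))
          (sigma_sets (space M) (sample_events M \<omega> {1..}))"
    and d_adapted: "\<And>i k. k \<ge> 1 \<Longrightarrow> d i k \<in> borel_measurable (history M (\<lambda>i. x i 0) \<omega> k)"
    and dfix_nonzero: "\<And>i. dfix i \<noteq> 0"
    and dap: "\<And>\<theta>. \<theta> \<in> space M \<Longrightarrow>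
          dap_run X0 Dg g (\<lambda>k. uniform_weights E) \<alpha> (\<lambda>i k. epi_cost) dfix
            (\<lambda>i k. \<omega> i k \<theta>) (\<lambda>i k. d i k \<theta>)
            (\<lambda>i k. p i k \<theta>) (\<lambda>i k. v i k \<theta>) (\<lambda>i k. x i k \<theta>)"
  shows "\<exists>xs. xs \<in> borel_measurable M \<and> (\<forall>\<theta>\<in>space M. xs \<theta> \<in> Xstar) \<and>
           (AE \<theta> in M. \<forall>i. (\<lambda>k. x i k \<theta>) \<longlonglongrightarrow> xs \<theta>)"
proof -
  interpret prob_space M by (rule M)
  let ?a = "epi_cost :: (real ^ 'n) \<times> (real ^ 'v)"
  let ?F = "history M (\<lambda>i. x i 0) \<omega>"

  \<comment> \<open>Topology of the feasible set and of the optimal set\<close>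
  have X0: "closed X0" "convex X0" "X0 \<noteq> {}"
    using Y0 by (auto simp: X0_def intro: closed_Times convex_Times)
  have sample: "\<omega> i k \<in> M \<rightarrow>\<^sub>M count_space (\<Omega> i)" if "k \<ge> 1" for i k
    using samples_indep that by (auto simp: indep_vars_def)
  have sample_in: "\<omega> i k \<theta> \<in> \<Omega> i" if "k \<ge> 1" "\<theta> \<in> space M" for i k \<theta>
    using measurable_space[OF sample[OF that(1)] that(2)] by simp
  have sample_UNIV: "\<omega> i k \<in> M \<rightarrow>\<^sub>M count_space UNIV" if "k \<ge> 1" for i k
    using measurable_compose[OF sample[OF that], where g = "\<lambda>w. w" and L = "count_space UNIV"] by simp
  have g_cont: "continuous_on X0 (\<lambda>z. g z w)" if "w \<in> \<Omega> i" for i w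
    using g_convex[OF that] convex_on_continuous continuous_on_subset by blast
  then have pos_cont: "continuous_on X0 (\<lambda>z. pos_part g z w)" if "w \<in> \<Omega> i" for i w
    unfolding pos_part_def using that by (intro continuous_intros)
  have X_sub: "X \<subseteq> X0" by (auto simp: X_def feasible_set_def)
  have g_X: "g z w \<le> 0" if "z \<in> X" "w \<in> \<Omega> i" for z w i
    using that by (auto simp: X_def feasible_set_def)
  \<comment> \<open>The sublevel sets are taken inside \<open>X0\<close>, where convexity on an open
    domain yields continuity.\<close>
  have "X = X0 \<inter> (\<Inter>i. \<Inter>w\<in>\<Omega> i. {z \<in> X0. g z w \<le> 0})"
    by (auto simp: X_def feasible_set_def)
  also have "closed \<dots>"
    using X0(1) by (intro closed_Int closed_INT ballI continuous_on_closed_Collect_le) (auto intro: g_cont)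
  finally have X_closed: "closed X" .
  have Xstar_iff: "z \<in> Xstar \<longleftrightarrow> z \<in> X \<and> (\<forall>y\<in>X. inner ?a z \<le> inner ?a y)" for z
    by (auto simp: Xstar_def argmin_set_def is_arg_min_def not_less)
  obtain zs where zs: "zs \<in> Xstar" using Xstar_nonempty by auto
  then have zs_X: "zs \<in> X" and zs_min: "\<And>y. y \<in> X \<Longrightarrow> inner ?a zs \<le> inner ?a y"
    by (auto simp: Xstar_iff)
  \<comment> \<open>Comparison with one optimal point replaces the quantifier over \<open>X\<close>;
    closedness makes \<open>Xstar\<close> a Borel set for the definition of the random
    limit.\<close>
  have "Xstar = X \<inter> {z. inner ?a z \<le> inner ?a zs}"
    using zs by (auto simp: Xstar_iff) (meson order.trans)
  also have "closed \<dots>"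
    by (intro closed_Int X_closed closed_Collect_le continuous_intros)
  finally have Xstar_closed: "closed Xstar" .

  \<comment> \<open>Network weights and constants common to all agents\<close>
  define W where "W = uniform_weights E"
  have card_pos: "card (in_nbrs E i) > 0" for i
    by (auto simp: card_gt_0_iff in_nbrs_def)
  have W_nonneg: "W $ i $ j \<ge> 0" for i j by (simp add: W_def uniform_weights_def)
  have W_rows: "(\<Sum>j\<in>UNIV. W $ i $ j) = 1" for i
    using card_pos[of i] by (auto simp: W_def uniform_weights_def simp flip: sum.inter_filter)
  have W_edge: "W $ i $ j > 0" if "(j, i) \<in> E" for i j
    using that card_pos[of i] by (simp add: W_def uniform_weights_def in_nbrs_def)
  have W_self: "W $ i $ i > 0" for i
    using card_pos[of i] by (simp add: W_def uniform_weights_def in_nbrs_def)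
  obtain \<pi> :: "'v \<Rightarrow> real" where \<pi>: "\<And>i. \<pi> i > 0" "(\<Sum>i\<in>UNIV. \<pi> i) = 1"
    "\<And>j. (\<Sum>i\<in>UNIV. \<pi> i * W $ i $ j) = \<pi> j"
    using stationary_weights_exist[OF W_nonneg W_rows W_edge strongly_connected] by metis

  obtain Cg where Cg: "\<And>i w z u. w \<in> \<Omega> i \<Longrightarrow> z \<in> X0 \<Longrightarrow>
      u \<in> subdifferential (Dg w) (\<lambda>z. pos_part g z w) z \<Longrightarrow> norm u \<le> Cg"
    using g_subgrad by blast
  define C where "C = max Cg 1"
  have C: "C > 0" by (simp add: C_def)
  obtain ci where ci: "\<And>i. ci i > 0" "\<And>i z. z \<in> X0 \<Longrightarrow>
      (infdist z X)\<^sup>2 \<le> ci i * measure_pmf.expectation (P i) (\<lambda>w. (pos_part g z w)\<^sup>2)"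
    using regularity by metis
  \<comment> \<open>The sum dominates the constant of every agent, so one \<open>c\<close> serves
    all.\<close>
  define c where "c = (\<Sum>i\<in>UNIV. ci i)"
  have c: "c > 0" unfolding c_def by (intro sum_pos ci) auto
  have c_reg: "(infdist z X)\<^sup>2 \<le> c * measure_pmf.expectation (P i) (\<lambda>w. (pos_part g z w)\<^sup>2)"
    if "z \<in> X0" for i z
  proof -
    have "ci i \<le> c" unfolding c_def by (rule member_le_sum) (auto intro: less_imp_le ci)
    then show ?thesis
      by (intro order.trans[OF ci(2)[OF that, of i]] mult_right_mono integral_nonneg_AE AE_pmfI) auto
  qed

  \<comment> \<open>Every realization as an instance of \<open>dap_path\<close>\<close>
  define h where "h i k \<theta> = pos_part g (v i k \<theta>) (\<omega> i k \<theta>)" for i k \<theta>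
  have p_eq: "p i (Suc n) \<theta> = (\<Sum>j\<in>UNIV. W $ i $ j *\<^sub>R x j n \<theta>)"
    and v_eq: "v i (Suc n) \<theta> = closest_point X0 (p i (Suc n) \<theta> - \<alpha> (Suc n) *\<^sub>R ?a)"
    and d_sub: "h i (Suc n) \<theta> > 0 \<Longrightarrow> d i (Suc n) \<theta> \<in>
      subdifferential (Dg (\<omega> i (Suc n) \<theta>)) (\<lambda>z. pos_part g z (\<omega> i (Suc n) \<theta>)) (v i (Suc n) \<theta>)"
    and x_eq: "x i (Suc n) \<theta> = closest_point X0
      (v i (Suc n) \<theta> - (h i (Suc n) \<theta> / (norm (d i (Suc n) \<theta>))\<^sup>2) *\<^sub>R d i (Suc n) \<theta>)"
    if "\<theta> \<in> space M" for i n \<theta>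
    using dap[OF that, unfolded dap_run_def, THEN conjunct2, THEN spec, of i, THEN spec, of "Suc n", simplified]
    unfolding h_def W_def by blast+
  have x_0: "x i 0 \<theta> \<in> X0" if "\<theta> \<in> space M" for i \<theta>
    using dap[OF that] by (simp add: dap_run_def)
  have v_in: "v i (Suc n) \<theta> \<in> X0" if "\<theta> \<in> space M" for i n \<theta>
    unfolding v_eq[OF that] using X0 by (intro closest_point_in_set)
  have path: "dap_path X0 X ?a E (\<lambda>i j. W $ i $ j) \<pi> \<alpha> C (\<lambda>i n. h i n \<theta>)
      (\<lambda>i n. p i n \<theta>) (\<lambda>i n. v i n \<theta>) (\<lambda>i n. x i n \<theta>)" if \<theta>: "\<theta> \<in> space M" for \<theta>
  proof
    show "x i n \<theta> \<in> X0" for i n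
      by (cases n) (simp_all add: x_0 x_eq \<theta> closest_point_in_set[OF X0(1,3)])
    fix i n z assume z: "z \<in> X"
    let ?w = "\<omega> i (Suc n) \<theta>"
    have w: "?w \<in> \<Omega> i" using sample_in \<theta> by simp
    have *: "norm (d i (Suc n) \<theta>) \<le> C" if "h i (Suc n) \<theta> > 0"
      using Cg[OF w v_in[OF \<theta>] d_sub[OF \<theta> that]] by (simp add: C_def)
    show "(norm (x i (Suc n) \<theta> - z))\<^sup>2 + (h i (Suc n) \<theta>)\<^sup>2 / C\<^sup>2 \<le> (norm (v i (Suc n) \<theta> - z))\<^sup>2"
      unfolding x_eq[OF \<theta>] unfolding h_def
    proof (rule polyak_step[OF X0(2,1), where D = "Dg ?w"])
      show "z \<in> X0" "z \<in> Dg ?w" using z X_sub g_convex[OF w] by auto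
      show "pos_part g z ?w \<le> 0" using g_X[OF z w] by (simp add: pos_part_def)
    qed (use d_sub[OF \<theta>] * C in \<open>auto simp: h_def pos_part_def\<close>)
  qed (use X0 X_closed X_sub zs_X W_nonneg W_rows W_edge W_self strongly_connected \<pi> alpha_nonneg
      p_eq[OF \<theta>] v_eq[OF \<theta>] in auto)

  \<comment> \<open>Measurability along the history\<close>
  have F_sub: "sets (?F k) \<subseteq> events" for k
    by (rule sets_history_subset_events) (auto intro: x_init_measurable sample_UNIV)
  then have "subalgebra M (?F k)" for k by (simp add: subalgebra_def)
  note F_M = measurable_from_subalg[OF this]
  have proj_meas: "closest_point X0 \<in> borel_measurable borel"
    by (intro borel_measurable_continuous_onI continuous_on_closest_point X0)
  \<comment> \<open>The point \<open>v\<close> at time \<open>Suc n\<close> is formed before the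
    sample of that time enters, so the history up to \<open>n\<close> determines it. Independence of
    that sample rests on this shift.\<close>
  have v_F: "v i (Suc n) \<in> borel_measurable (?F n)" if "\<And>j. x j n \<in> borel_measurable (?F n)" for i n
  proof -
    have "(\<lambda>\<theta>. closest_point X0 ((\<Sum>j\<in>UNIV. W $ i $ j *\<^sub>R x j n \<theta>) - \<alpha> (Suc n) *\<^sub>R ?a)) \<in> borel_measurable (?F n)"
      by (rule measurable_compose[OF _ proj_meas])
        (intro borel_measurable_diff borel_measurable_sum borel_measurable_scaleR borel_measurable_const that)
    then show ?thesis
      by (subst measurable_cong) (auto simp: v_eq p_eq)
  qed
  \<comment> \<open>Continuity of the constraints is available on \<open>X0\<close>, so the
    composition goes through the restriction to \<open>X0\<close>, which contains
    \<open>v\<close>.\<close>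
  have g_v_F: "(\<lambda>\<theta>. pos_part g (v i (Suc n) \<theta>) w) \<in> borel_measurable N"
    if "v i (Suc n) \<in> borel_measurable N" "w \<in> \<Omega> i" "space N = space M" for i n w N
    using that v_in
    by (intro measurable_compose[OF measurable_restrict_space2
          borel_measurable_continuous_on_restrict[OF pos_cont[OF that(2)]]]) auto
  have h_F: "h i (Suc n) \<in> borel_measurable (?F (Suc n))" if "v i (Suc n) \<in> borel_measurable (?F (Suc n))" for i n
    unfolding h_def
    by (rule measurable_compose_countable'[where I = "\<Omega> i"])
      (auto intro!: g_v_F that sample_measurable_history sample_in countable_finite Omega_finite)
  have x_F: "x i n \<in> borel_measurable (?F n)" for i n
  proof (induction n arbitrary: i)
    case 0
    show ?case by (rule initial_measurable_history)
  next
    case (Suc n)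
    have [measurable]: "v i (Suc n) \<in> borel_measurable (?F (Suc n))"
      by (rule measurable_history_mono[OF v_F[OF Suc.IH]]) simp
    have [measurable]: "h i (Suc n) \<in> borel_measurable (?F (Suc n))" by (rule h_F) measurable
    have [measurable]: "d i (Suc n) \<in> borel_measurable (?F (Suc n))" by (rule d_adapted) simp
    have "(\<lambda>\<theta>. closest_point X0
        (v i (Suc n) \<theta> - (h i (Suc n) \<theta> / (norm (d i (Suc n) \<theta>))\<^sup>2) *\<^sub>R d i (Suc n) \<theta>)) \<in> borel_measurable (?F (Suc n))"
      by (rule measurable_compose[OF _ proj_meas]) measurable
    then show ?case
      by (subst measurable_cong) (auto simp: x_eq)
  qed
  have v_F': "v i (Suc n) \<in> borel_measurable (?F n)" for i n by (rule v_F[OF x_F])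
  have x_meas: "x i n \<in> borel_measurable M" for i n by (rule F_M[OF x_F])
  have v_meas: "v i (Suc n) \<in> borel_measurable M" for i n by (rule F_M[OF v_F'])
  have h_meas: "h i (Suc n) \<in> borel_measurable M" for i n
    by (rule F_M[OF h_F]) (rule measurable_history_mono[OF v_F'], simp)

  \<comment> \<open>The truncating event depends on the initial points alone, so the sample is fresh
    for each \<open>\<psi> w\<close>. Averaging over the sample first allows (B4) to be applied at
    every \<open>\<theta>\<close>.\<close>
  have reg: "expectation (\<lambda>\<theta>. indicator {\<theta>. \<forall>j. norm (x j 0 \<theta> - zs) \<le> R} \<theta> * (infdist (v i (Suc n) \<theta>) X)\<^sup>2)
      \<le> c * expectation (\<lambda>\<theta>. indicator {\<theta>. \<forall>j. norm (x j 0 \<theta> - zs) \<le> R} \<theta> * (h i (Suc n) \<theta>)\<^sup>2)" for R i n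
  proof -
    define I :: "'a \<Rightarrow> real" where "I = indicator {\<theta>. \<forall>j. norm (x j 0 \<theta> - zs) \<le> R}"
    define \<psi> where "\<psi> w \<theta> = I \<theta> * (pos_part g (v i (Suc n) \<theta>) w)\<^sup>2" for w \<theta>
    have [measurable]: "x j 0 \<in> borel_measurable (?F n)" for j by (rule initial_measurable_history)
    have "I \<in> borel_measurable (?F n)" unfolding I_def by measurable
    then have \<psi>_F: "\<psi> w \<in> borel_measurable (?F n)" if "w \<in> \<Omega> i" for w
      unfolding \<psi>_def using g_v_F[OF v_F' that space_history] by measurable
    have I_01: "I \<theta> = 0 \<or> I \<theta> = 1" for \<theta> by (auto simp: I_def indicator_def)
    define B where "B = R + (\<Sum>t<Suc n. \<alpha> (Suc t) * norm ?a)"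
    have v_B: "v i (Suc n) \<theta> \<in> X0 \<inter> cball zs B" if "\<theta> \<in> space M" "I \<theta> \<noteq> 0" for \<theta>
    proof -
      have "norm (x j 0 \<theta> - zs) \<le> R" for j
        using that(2) by (auto simp: I_def indicator_def split: if_splits)
      from dap_path.iterates_bounded(2)[OF path[OF that(1)] zs_X this]
      show ?thesis using v_in[OF that(1)] by (simp add: B_def dist_norm norm_minus_commute)
    qed
    \<comment> \<open>Where \<open>I\<close> is nonzero, \<open>v\<close> stays in a compact part of
      \<open>X0\<close>, on which the continuous residual is bounded.\<close>
    have \<psi>_int: "integrable M (\<psi> w)" if w: "w \<in> \<Omega> i" for w
    proof -
      have "continuous_on (X0 \<inter> cball zs B) (\<lambda>z. (pos_part g z w)\<^sup>2)"
        by (intro continuous_intros continuous_on_subset[OF pos_cont[OF w]]) auto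
      then have "bounded ((\<lambda>z. (pos_part g z w)\<^sup>2) ` (X0 \<inter> cball zs B))"
        using X0(1) by (intro compact_imp_bounded compact_continuous_image closed_Int_compact) auto
      then obtain K where K: "\<And>z. z \<in> X0 \<inter> cball zs B \<Longrightarrow> norm ((pos_part g z w)\<^sup>2) \<le> K" and "K > 0"
        unfolding bounded_pos by blast
      show ?thesis
      proof (rule integrable_const_bound[of _ K])
        show "\<psi> w \<in> borel_measurable M" by (rule F_M[OF \<psi>_F[OF w]])
        show "AE \<theta> in M. norm (\<psi> w \<theta>) \<le> K"
        proof (rule AE_I2)
          fix \<theta> assume "\<theta> \<in> space M"
          then show "norm (\<psi> w \<theta>) \<le> K"
            using I_01[of \<theta>] K[OF v_B[of \<theta>]] \<open>K > 0\<close> by (auto simp: \<psi>_def)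
        qed
      qed
    qed
    have "expectation (\<lambda>\<theta>. \<psi> (\<omega> i (Suc n) \<theta>) \<theta>) = expectation (\<lambda>\<theta>. measure_pmf.expectation (P i) (\<lambda>w. \<psi> w \<theta>))"
      by (rule expectation_fresh_sample[OF space_history F_sub sample_UNIV
            indep_history_sample[OF samples_indep x_init_indep] samples_distr])
        (auto simp: samples_support Omega_finite sample_in intro!: \<psi>_F \<psi>_int)
    then have E_h: "expectation (\<lambda>\<theta>. I \<theta> * (h i (Suc n) \<theta>)\<^sup>2)
        = expectation (\<lambda>\<theta>. measure_pmf.expectation (P i) (\<lambda>w. \<psi> w \<theta>))"
      by (simp add: \<psi>_def h_def)
    have E_\<psi>: "measure_pmf.expectation (P i) (\<lambda>w. \<psi> w \<theta>) = (\<Sum>w\<in>\<Omega> i. \<psi> w \<theta> * pmf (P i) w)" for \<theta>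
      by (rule integral_measure_pmf_real) (auto simp: Omega_finite samples_support)
    have "expectation (\<lambda>\<theta>. I \<theta> * (infdist (v i (Suc n) \<theta>) X)\<^sup>2)
      \<le> expectation (\<lambda>\<theta>. c * measure_pmf.expectation (P i) (\<lambda>w. \<psi> w \<theta>))"
    proof (rule integral_mono')
      show "integrable M (\<lambda>\<theta>. c * measure_pmf.expectation (P i) (\<lambda>w. \<psi> w \<theta>))"
        unfolding E_\<psi> using \<psi>_int by simp
      fix \<theta> assume \<theta>: "\<theta> \<in> space M"
      show "I \<theta> * (infdist (v i (Suc n) \<theta>) X)\<^sup>2 \<le> c * measure_pmf.expectation (P i) (\<lambda>w. \<psi> w \<theta>)"
        using I_01[of \<theta>] c_reg[OF v_in[OF \<theta>]] by (auto simp: \<psi>_def)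
      show "0 \<le> c * measure_pmf.expectation (P i) (\<lambda>w. \<psi> w \<theta>)"
        using I_01[of \<theta>] c by (intro mult_nonneg_nonneg integral_nonneg_AE AE_pmfI) (auto simp: \<psi>_def)
    qed
    then show ?thesis by (simp add: E_h I_def[symmetric])
  qed
  have dist_AE: "AE \<theta> in M. \<forall>i. summable (\<lambda>n. (infdist (v i (Suc n) \<theta>) X)\<^sup>2)"
    by (rule AE_summable_infdist[OF path x_meas v_meas h_meas zs_X zs_min C c alpha_square_sum reg])

  \<comment> \<open>The random limit point\<close>
  have \<alpha>_div: "filterlim (\<lambda>N. \<Sum>n<N. \<alpha> (Suc n)) at_top sequentially"
    using alpha_sum by (simp add: sum.atLeast1_atMost_eq)
  fix i0 :: 'v
  define L where "L \<theta> = lim (\<lambda>n. x i0 n \<theta>)" for \<theta>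
  \<comment> \<open>Where the iterates do not converge, \<open>lim\<close> is an unspecified value;
    the default \<open>zs\<close> keeps \<open>xs\<close> in \<open>Xstar\<close> for every
    \<open>\<theta>\<close>.\<close>
  define xs where "xs \<theta> = (if L \<theta> \<in> Xstar then L \<theta> else zs)" for \<theta>
  have L_meas [measurable]: "L \<in> borel_measurable M"
    unfolding L_def by (rule borel_measurable_lim_metric[OF x_meas])
  have [measurable]: "Xstar \<in> sets borel" using Xstar_closed by simp
  have "xs \<in> borel_measurable M" unfolding xs_def by measurable
  moreover have "xs \<theta> \<in> Xstar" for \<theta> by (simp add: xs_def zs)
  moreover have "AE \<theta> in M. \<forall>i. (\<lambda>k. x i k \<theta>) \<longlonglongrightarrow> xs \<theta>"
    using dist_AE AE_space
  proof eventually_elim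
    case (elim \<theta>)
    obtain l where l: "l \<in> X" "inner ?a l = inner ?a zs" "\<And>i. (\<lambda>n. x i n \<theta>) \<longlonglongrightarrow> l"
      using dap_path.converges[OF path[OF elim(2)] zs_X zs_min \<alpha>_div alpha_square_sum elim(1)[rule_format]]
      by metis
    have "L \<theta> = l" unfolding L_def by (rule limI[OF l(3)])
    moreover have "l \<in> Xstar" using l(1,2) zs_min by (simp add: Xstar_iff)
    ultimately have "xs \<theta> = l" by (simp add: xs_def)
    with l(3) show ?case by simp
  qed
  ultimately show ?thesis by blast
qed

end
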